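(* Let $A^2$ be the DGLA described in the context, and put $v=\mathrm{BCH}\!\left(-\tfrac12\mathrm{BCH}(e,f),\,e\right)$, $q=\mathrm{BCH}\!\left(-\tfrac v2,\,e,\,f,\,\tfrac v2\right)\in A^2_0$ and $x=u_{v/2}(a)\in A^2_{-1}$. Let $\bar A^2$ be the (completed) free graded Lie algebra on $a,b$ (degree $-1$), $e,f$ (degree $0$) and $g$ (degree $1$), with derivation $\partial$ of degree $-1$ extending that of $A^2$ and defined on $g$ by $$\partial g=q-[x,g].$$ Then $\partial^2=0$ on $\bar A^2$, so $\bar A^2$ is a DGLA extending $A^2$; the part of $\partial g$ without Lie brackets is $e+f$; and $\bar A^2$ is symmetric: the automorphism $\sigma$ extended by $g\mapsto g$ and the automorphism $\iota$ extended by $g\mapsto -g$ are automorphisms of $\bar A^2$ commuting with $\partial$. In particular $\bar A^2$ is a model of the bi-gon (two vertices $a,b$, two edges $e,f$ with geometric boundaries $b-a$ and $a-b$, one 2-cell $g$ with geometric boundary $e+f$) invariant under its full symmetry group (the Klein four-group generated by $\sigma$ and $\iota$), and $\partial_x g=q\in A^2$.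
   Context: Work over $\mathbb{Q}$; all Lie algebras are completed with respect to bracket length so that the infinite series below converge. $A^2$ is the (completed) free graded Lie algebra on generators $a,b$ of degree $-1$ and $e,f$ of degree $0$, with the derivation $\partial$ of degree $-1$ determined by $\partial a=-\tfrac12[a,a]$, $\partial b=-\tfrac12[b,b]$, $\partial e=\frac{E}{1-e^{E}}a+\frac{E}{1-e^{-E}}b$, $\partial f=\frac{F}{1-e^{F}}b+\frac{F}{1-e^{-F}}a$, where $E=\mathrm{ad}_e$, $F=\mathrm{ad}_f$ and the functions of $E,F$ are their formal power series; $\partial^2=0$ on $A^2$. $\mathrm{BCH}(x,y)$ is the Baker–Campbell–Hausdorff series, the unique Lie series with $\exp(x)\exp(y)=\exp(\mathrm{BCH}(x,y))$, and $\mathrm{BCH}(x_1,\dots,x_n)$ is its iterate, with $\exp(x_1)\cdots\exp(x_n)=\exp(\mathrm{BCH}(x_1,\dots,x_n))$. For $w\in A_0$ and $y\in A_{-1}$, $u_w(y)$ is $z(1)$ where $z(t)\in A_{-1}$ solves $\frac{dz}{dt}=\partial w-\mathrm{ad}_w(z)$, $z(0)=y$. For $y\in A_{-1}$, $\partial_y=\partial+\mathrm{ad}_y$. The automorphism $\sigma$ of $A^2$ is defined on generators by $a\leftrightarrow b$, $e\leftrightarrow f$; the automorphism $\iota$ by $a\mapsto a$, $b\mapsto b$, $e\mapsto -f$, $f\mapsto -e$; both commute with $\partial$ on $A^2$. *)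

theory Defs
  imports "HOL-Analysis.Analysis" "HOL-Computational_Algebra.Formal_Power_Series"
begin

datatype gen = Ga | Gb | Ge | Gf | Gg

definition gens :: "gen set" where "gens = {Ga, Gb, Ge, Gf, Gg}"

fun gdeg :: "gen \<Rightarrow> int" where
  "gdeg Ga = -1" | "gdeg Gb = -1" | "gdeg Ge = 0" | "gdeg Gf = 0" | "gdeg Gg = 1"

definition wdeg :: "gen list \<Rightarrow> int" where
  "wdeg w = sum_list (map gdeg w)"

definition wsign :: "gen list \<Rightarrow> 'r::comm_ring_1" where
  "wsign w = (-1) ^ length (filter (\<lambda>x. odd (gdeg x)) w)"

text \<open>A (completed) series in the free graded associative algebra on the generators:
  a coefficient for every word.  The completed free graded Lie algebra is embedded in it.\<close>
type_synonym 'r series = "gen list \<Rightarrow> 'r"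

definition gen_s :: "gen \<Rightarrow> 'r::comm_ring_1 series" where
  "gen_s x = (\<lambda>w. if w = [x] then 1 else 0)"

definition one_s :: "'r::comm_ring_1 series" where
  "one_s = (\<lambda>w. if w = [] then 1 else 0)"

definition mult_s :: "'r::comm_ring_1 series \<Rightarrow> 'r series \<Rightarrow> 'r series" where
  "mult_s X Y = (\<lambda>w. \<Sum>i\<le>length w. X (take i w) * Y (drop i w))"

text \<open>Graded commutator [X,Y] = XY - (-1)^(|X||Y|) YX, extended bilinearly.\<close>
definition brk :: "'r::comm_ring_1 series \<Rightarrow> 'r series \<Rightarrow> 'r series" where
  "brk X Y = (\<lambda>w. \<Sum>i\<le>length w.
      X (take i w) * Y (drop i w)
      - (if odd (wdeg (take i w)) \<and> odd (wdeg (drop i w)) then -1 else 1)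
          * Y (take i w) * X (drop i w))"

definition smul_s :: "'r::comm_ring_1 \<Rightarrow> 'r series \<Rightarrow> 'r series" where
  "smul_s c X = (\<lambda>w. c * X w)"

fun pow_s :: "'r::comm_ring_1 series \<Rightarrow> nat \<Rightarrow> 'r series" where
  "pow_s X 0 = one_s"
| "pow_s X (Suc n) = mult_s X (pow_s X n)"

inductive_set lie_poly :: "rat series set" where
  gen: "gen_s x \<in> lie_poly"
| add: "X \<in> lie_poly \<Longrightarrow> Y \<in> lie_poly \<Longrightarrow> (\<lambda>w. X w + Y w) \<in> lie_poly"
| smul: "X \<in> lie_poly \<Longrightarrow> smul_s c X \<in> lie_poly"
| brk: "X \<in> lie_poly \<Longrightarrow> Y \<in> lie_poly \<Longrightarrow> brk X Y \<in> lie_poly"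

definition len_part :: "nat \<Rightarrow> 'r::zero series \<Rightarrow> 'r series" where
  "len_part n X = (\<lambda>w. if length w = n then X w else 0)"

text \<open>Completion with respect to bracket length: every homogeneous (in word length) component
  is a Lie polynomial.\<close>
definition lie_series :: "rat series \<Rightarrow> bool" where
  "lie_series X \<longleftrightarrow> (\<forall>n. len_part n X \<in> lie_poly)"

definition Abar :: "int \<Rightarrow> rat series set" where
  "Abar d = {X. lie_series X \<and> (\<forall>w. X w \<noteq> 0 \<longrightarrow> wdeg w = d)}"

definition inA :: "rat series \<Rightarrow> bool" where
  "inA X \<longleftrightarrow> lie_series X \<and> (\<forall>w. X w \<noteq> 0 \<longrightarrow> Gg \<notin> set w)"

definition A2 :: "int \<Rightarrow> rat series set" where
  "A2 d = {X. X \<in> Abar d \<and> inA X}"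

text \<open>The unique (completed) odd derivation with given values on generators:
  der(p x s) = sum of (-1)^|p| p (delta x) s.  Meaningful when all delta x have
  zero constant term (then each coefficient is a finite sum).\<close>
definition der :: "(gen \<Rightarrow> rat series) \<Rightarrow> rat series \<Rightarrow> rat series" where
  "der \<delta> X = (\<lambda>w. \<Sum>i<length w. \<Sum>j\<in>{i<..length w}. \<Sum>x\<in>gens.
      wsign (take i w) * X (take i w @ [x] @ drop j w) * \<delta> x (take (j - i) (drop i w)))"

text \<open>phi(ad_Y) Z = sum_n phi_n (ad_Y)^n Z (converges when Y has zero constant term).\<close>
definition fps_ad :: "rat fps \<Rightarrow> rat series \<Rightarrow> rat series \<Rightarrow> rat series" where
  "fps_ad \<phi> Y Z = (\<lambda>w. \<Sum>n\<le>length w. fps_nth \<phi> n * ((brk Y ^^ n) Z) w)"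

definition phi1 :: "rat fps" where "phi1 = fps_X div (1 - fps_exp 1)"
definition phi2 :: "rat fps" where "phi2 = fps_X div (1 - fps_exp (-1))"

text \<open>Values of the differential of A^2 on generators (g is sent to 0 here; A^2 does not
  contain g).\<close>
fun deltaA :: "gen \<Rightarrow> rat series" where
  "deltaA Ga = smul_s (-1/2) (brk (gen_s Ga) (gen_s Ga))"
| "deltaA Gb = smul_s (-1/2) (brk (gen_s Gb) (gen_s Gb))"
| "deltaA Ge = (\<lambda>w. fps_ad phi1 (gen_s Ge) (gen_s Ga) w + fps_ad phi2 (gen_s Ge) (gen_s Gb) w)"
| "deltaA Gf = (\<lambda>w. fps_ad phi1 (gen_s Gf) (gen_s Gb) w + fps_ad phi2 (gen_s Gf) (gen_s Ga) w)"
| "deltaA Gg = (\<lambda>w. 0)"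

definition dA :: "rat series \<Rightarrow> rat series" where "dA = der deltaA"

definition exp_s :: "rat series \<Rightarrow> rat series" where
  "exp_s X = (\<lambda>w. \<Sum>n\<le>length w. pow_s X n w / fact n)"

text \<open>log(1 + Y) for Y with zero constant term.\<close>
definition log1p_s :: "rat series \<Rightarrow> rat series" where
  "log1p_s Y = (\<lambda>w. \<Sum>n\<in>{1..length w}. (-1) ^ (n + 1) / of_nat n * pow_s Y n w)"

definition BCH :: "rat series list \<Rightarrow> rat series" where
  "BCH xs = log1p_s (\<lambda>w. foldr (\<lambda>X P. mult_s (exp_s X) P) xs one_s w - one_s w)"

text \<open>u_W(Y) = z(1), where z(t) solves dz/dt = dW - ad_W(z), z(0) = Y.  The ODE is read
  coefficientwise, with real time t and real-valued coefficients (the rational series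
  are embedded via of_rat); u_W(Y) is the rational series whose embedding is z(1).\<close>
definition u_flow :: "rat series \<Rightarrow> rat series \<Rightarrow> rat series" where
  "u_flow W Y = (THE U. \<exists>z :: real \<Rightarrow> real series.
      (\<forall>w. z 0 w = of_rat (Y w)) \<and>
      (\<forall>t w. ((\<lambda>s. z s w) has_real_derivative
               (of_rat (dA W w) - brk (\<lambda>v. of_rat (W v)) (z t) w)) (at t)) \<and>
      (\<forall>w. z 1 w = of_rat (U w)))"

definition v_el :: "rat series" where
  "v_el = BCH [smul_s (-1/2) (BCH [gen_s Ge, gen_s Gf]), gen_s Ge]"

definition q_el :: "rat series" where
  "q_el = BCH [smul_s (-1/2) v_el, gen_s Ge, gen_s Gf, smul_s (1/2) v_el]"

definition x_el :: "rat series" where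
  "x_el = u_flow (smul_s (1/2) v_el) (gen_s Ga)"

fun deltaBar :: "gen \<Rightarrow> rat series" where
  "deltaBar Gg = (\<lambda>w. q_el w - brk x_el (gen_s Gg) w)"
| "deltaBar y = deltaA y"

definition dBar :: "rat series \<Rightarrow> rat series" where "dBar = der deltaBar"

fun sig_g :: "gen \<Rightarrow> gen" where
  "sig_g Ga = Gb" | "sig_g Gb = Ga" | "sig_g Ge = Gf" | "sig_g Gf = Ge" | "sig_g Gg = Gg"

fun iota_g :: "gen \<Rightarrow> gen" where
  "iota_g Ga = Ga" | "iota_g Gb = Gb" | "iota_g Ge = Gf" | "iota_g Gf = Ge" | "iota_g Gg = Gg"

definition sigma_s :: "rat series \<Rightarrow> rat series" where
  "sigma_s X = (\<lambda>w. X (map sig_g w))"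

definition iota_s :: "rat series \<Rightarrow> rat series" where
  "iota_s X = (\<lambda>w. (-1) ^ length (filter (\<lambda>y. y \<in> {Ge, Gf, Gg}) w) * X (map iota_g w))"

end

theory Submission
  imports Defs
begin

text \<open>
  Everything is computed in the ring of noncommutative power series, where the gauge action is
  \<open>u_w(y) = exp(-w) y exp(w) + exp(-w) d(exp w)\<close>. The differential on edges then reads
  \<open>d(exp e) = exp(e) b - a exp(e)\<close>, so \<open>d^2\<close> kills \<open>exp e\<close>, hence \<open>e\<close>, and \<open>h = exp(e) exp(f)\<close>
  and all its rational powers are annihilated by \<open>d_a = d + ad_a\<close>. With \<open>s = exp(v/2)\<close> one has
  \<open>s^2 = h^(-1/2) exp(e)\<close> and \<open>exp q = s^(-1) h s\<close>, so \<open>x\<close> is a Maurer-Cartan element half way from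
  \<open>a\<close> to \<open>b\<close> and \<open>d_x q = 0\<close>; these two facts give \<open>d^2 g = 0\<close>. The symmetries satisfy
  \<open>sigma(s) = s^(-1)\<close> and \<open>iota(s) = s\<close>, which makes \<open>x\<close> invariant and sends \<open>q\<close> to \<open>q\<close> and \<open>-q\<close>.
  That BCH series are Lie series follows by differentiating with the derivation that multiplies
  every word by its length.
\<close>

subsection \<open>The ring of noncommutative series\<close>

text \<open>The element \<open>v\<close> is a path from a to b balanced between the two edges. Both
  exp(e) and exp(-f) transport a to b, and exp(e) = h exp(-f); hence h^(-1/2) exp(e) = h^(1/2)
  exp(-f), and this is exp(v). The balance is what makes \<open>iota\<close> fix \<open>v\<close>
  and \<open>sigma\<close> reverse it. Two definitions resist algebra: BCH is an associative
  logarithm, which says nothing about being Lie, and the flow is a definite description over a real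
  differential equation. Both are first replaced by closed formulas in the ring. Identities are then
  proved for arbitrary series, because D D and commutation defects of D with a symmetry are twisted
  derivations and so are determined on generators; being Lie is a separate matter. The edges enter
  through their exponentials, on which the infinite series in the values of d on e and f collapse to
  two terms. The copy \<open>ser\<close> of the function type carries the concatenation product as
  its ring multiplication.\<close>

typedef ser = "UNIV :: rat series set"
  morphisms cf Ser by simp

setup_lifting type_definition_ser

lemma cf_Ser [simp]: "cf (Ser X) = X"
  by (simp add: Ser_inverse)

lemma Ser_cf [simp]: "Ser (cf X) = X"
  by (rule cf_inverse)

lemma ser_eqI: "(\<And>w. cf X w = cf Y w) \<Longrightarrow> X = Y"
  by (metis cf_inject ext)

lemma mult_s_Nil: "mult_s X Y [] = X [] * Y []"
  by (simp add: mult_s_def)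

text \<open>Either the first letter belongs to the left factor or the left factor is empty. This
  recursion reduces associativity to an induction on the word.\<close>

lemma mult_s_Cons:
  "mult_s X Y (y # w) = mult_s (\<lambda>u. X (y # u)) Y w + X [] * Y (y # w)"
  unfolding mult_s_def by (simp add: sum.atMost_Suc_shift del: sum.atMost_Suc)

instantiation ser :: ring_1
begin

lift_definition zero_ser :: ser is "\<lambda>w. 0" .
lift_definition one_ser :: ser is one_s .
lift_definition plus_ser :: "ser \<Rightarrow> ser \<Rightarrow> ser" is "\<lambda>X Y w. X w + Y w" .
lift_definition minus_ser :: "ser \<Rightarrow> ser \<Rightarrow> ser" is "\<lambda>X Y w. X w - Y w" .
lift_definition uminus_ser :: "ser \<Rightarrow> ser" is "\<lambda>X w. - X w" .
lift_definition times_ser :: "ser \<Rightarrow> ser \<Rightarrow> ser" is mult_s .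

lemma mult_s_assoc: "mult_s (mult_s X Y) Z w = mult_s X (mult_s Y Z) w" for X Y Z :: "rat series"
proof (induction w arbitrary: X Y Z)
  case Nil
  then show ?case by (simp add: mult_s_Nil)
next
  case (Cons y w)
  have lin: "mult_s (\<lambda>u. A u + c * B u) C w = mult_s A C w + c * mult_s B C w"
    for A B C :: "rat series" and c
    by (simp add: mult_s_def algebra_simps sum.distrib sum_distrib_left)
  show ?case
    by (simp add: mult_s_Cons[of _ _ y] mult_s_Nil lin Cons.IH) (simp add: algebra_simps)
qed

lemma mult_s_one: "mult_s one_s X w = X w" "mult_s X one_s w = X w" for X :: "rat series"
proof -
  have z: "mult_s (\<lambda>u. 0) Y w = 0" for Y :: "rat series" and w by (simp add: mult_s_def)
  have "mult_s one_s X w = X w"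
    by (cases w) (simp_all add: mult_s_Nil mult_s_Cons one_s_def z)
  moreover have "mult_s X one_s w = X w"
    by (induction w arbitrary: X) (simp_all add: mult_s_Nil mult_s_Cons one_s_def)
  ultimately show "mult_s one_s X w = X w" "mult_s X one_s w = X w" by auto
qed

instance
proof
  fix a b c :: ser
  show "a * b * c = a * (b * c)" by transfer (auto simp: fun_eq_iff mult_s_assoc)
  show "1 * a = a" "a * 1 = a" by (transfer; simp add: fun_eq_iff mult_s_one)+
  show "(a + b) * c = a * c + b * c" "a * (b + c) = a * b + a * c"
    by (transfer; simp add: fun_eq_iff mult_s_def algebra_simps sum.distrib)+
  show "(0::ser) \<noteq> 1" by transfer (auto simp: fun_eq_iff one_s_def)
qed (transfer; simp add: fun_eq_iff)+

end

lemma cf_arith [simp]: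
  "cf 0 w = 0" "cf (X + Y) w = cf X w + cf Y w" "cf (X - Y) w = cf X w - cf Y w"
  "cf (- X) w = - cf X w"
  by (transfer; simp)+

lemma cf_sum [simp]: "cf (sum F A) w = (\<Sum>i\<in>A. cf (F i) w)"
  by (induction A rule: infinite_finite_induct) auto

lemma cf_1: "cf 1 w = (if w = [] then 1 else 0)"
  by transfer (simp add: one_s_def)

lemma cf_mult: "cf (X * Y) w = (\<Sum>i\<le>length w. cf X (take i w) * cf Y (drop i w))"
  by transfer (simp add: mult_s_def)

text \<open>The left derivative with respect to a letter: X is its constant term plus the sum of all
  y times \<open>hd_der y X\<close>.\<close>

definition hd_der :: "gen \<Rightarrow> ser \<Rightarrow> ser" where
  "hd_der y X = Ser (\<lambda>w. cf X (y # w))"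

lemma cf_hd_der [simp]: "cf (hd_der y X) w = cf X (y # w)"
  by (simp add: hd_der_def)

lemma cf_mult_Nil [simp]: "cf (X * Y) [] = cf X [] * cf Y []"
  by transfer (simp add: mult_s_Nil)

lemma cf_mult_Cons: "cf (X * Y) (y # w) = cf (hd_der y X * Y) w + cf X [] * cf Y (y # w)"
  by (simp add: times_ser.rep_eq mult_s_Cons hd_der_def)

definition scl :: "rat \<Rightarrow> ser \<Rightarrow> ser" (infixr \<open>\<bullet>\<close> 75) where
  "scl c X = Ser (\<lambda>w. c * cf X w)"
no_notation inner (infix \<open>\<bullet>\<close> 70)

lemma cf_scl [simp]: "cf (c \<bullet> X) w = c * cf X w"
  by (simp add: scl_def)

lemma scl_simps [simp]:
  "(c \<bullet> X) * Y = c \<bullet> (X * Y)" "X * (c \<bullet> Y) = c \<bullet> (X * Y)" "c \<bullet> d \<bullet> X = (c * d) \<bullet> X"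
  "1 \<bullet> X = X" "0 \<bullet> X = 0" "c \<bullet> 0 = 0" "(- c) \<bullet> X = - (c \<bullet> X)"
  by (rule ser_eqI; simp add: cf_mult sum_distrib_left algebra_simps sum_negf)+

lemma scl_distribs:
  "c \<bullet> (X + Y) = c \<bullet> X + c \<bullet> Y" "c \<bullet> (X - Y) = c \<bullet> X - c \<bullet> Y" "(c + d) \<bullet> X = c \<bullet> X + d \<bullet> X"
  "c \<bullet> (- X) = - (c \<bullet> X)"
  by (rule ser_eqI; simp add: algebra_simps)+

lemma scl_sum: "c \<bullet> sum F A = (\<Sum>i\<in>A. c \<bullet> F i)"
  by (rule ser_eqI) (simp add: sum_distrib_left)

lemma power_scl: "(c \<bullet> X) ^ n = c ^ n \<bullet> X ^ n"
  by (induction n) (simp_all add: mult.commute)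

subsection \<open>Filtration by word length\<close>

definition vanish :: "nat \<Rightarrow> ser \<Rightarrow> bool" where
  "vanish n X \<longleftrightarrow> (\<forall>w. length w < n \<longrightarrow> cf X w = 0)"

lemma vanish_0 [simp]: "vanish 0 X"
  by (simp add: vanish_def)

lemma vanish_1: "vanish (Suc 0) X \<longleftrightarrow> cf X [] = 0"
  by (auto simp: vanish_def)

lemma vanish_mono: "vanish n X \<Longrightarrow> m \<le> n \<Longrightarrow> vanish m X"
  by (auto simp: vanish_def)

lemma vanish_arith:
  "vanish n 0" "vanish n X \<Longrightarrow> vanish n Y \<Longrightarrow> vanish n (X + Y)"
  "vanish n X \<Longrightarrow> vanish n Y \<Longrightarrow> vanish n (X - Y)" "vanish n X \<Longrightarrow> vanish n (- X)"
  "vanish n X \<Longrightarrow> vanish n (c \<bullet> X)"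
  by (auto simp: vanish_def)

lemma vanish_mult:
  assumes "vanish m X" "vanish n Y"
  shows "vanish (m + n) (X * Y)"
  unfolding vanish_def
proof (intro allI impI)
  fix w :: "gen list" assume w: "length w < m + n"
  have "cf X (take i w) * cf Y (drop i w) = 0" if "i \<le> length w" for i
  proof (cases "i < m")
    case True
    then show ?thesis using assms(1) that by (simp add: vanish_def)
  next
    case False
    then have "length (drop i w) < n" using w that by simp
    then show ?thesis using assms(2) by (simp add: vanish_def)
  qed
  then show "cf (X * Y) w = 0" unfolding cf_mult by (intro sum.neutral) blast
qed

lemma vanish_power: "cf X [] = 0 \<Longrightarrow> vanish n (X ^ n)"
  by (induction n) (use vanish_mult[of "Suc 0" X] in \<open>auto simp: vanish_1\<close>)

text \<open>Preserving the filtration stands in for continuity: a coefficient of the value at a word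
  of length n depends only on coefficients at words of length at most n. Infinite sums can then be
  handled without a topology.\<close>

definition local_linear :: "(ser \<Rightarrow> ser) \<Rightarrow> bool" where
  "local_linear T \<longleftrightarrow> (\<forall>X Y. T (X + Y) = T X + T Y) \<and> (\<forall>c X. T (c \<bullet> X) = c \<bullet> T X)
     \<and> (\<forall>n X. vanish n X \<longrightarrow> vanish n (T X))"

lemma local_linearI:
  assumes "\<And>X Y. T (X + Y) = T X + T Y" "\<And>c X. T (c \<bullet> X) = c \<bullet> T X"
    "\<And>n X. vanish n X \<Longrightarrow> vanish n (T X)"
  shows "local_linear T"
  using assms by (simp add: local_linear_def)

lemma local_linearD:
  assumes "local_linear T"
  shows "T (X + Y) = T X + T Y" "T (c \<bullet> X) = c \<bullet> T X" "vanish n X \<Longrightarrow> vanish n (T X)"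
    "T 0 = 0" "T (- X) = - T X" "T (X - Y) = T X - T Y" "T (sum F A) = (\<Sum>i\<in>A. T (F i))"
proof -
  show add: "T (X + Y) = T X + T Y" for X Y using assms by (simp add: local_linear_def)
  show scl: "T (c \<bullet> X) = c \<bullet> T X" for c X using assms by (simp add: local_linear_def)
  show "vanish n X \<Longrightarrow> vanish n (T X)" using assms by (simp add: local_linear_def)
  show zero: "T 0 = 0" using scl[of 0 0] by simp
  show neg: "T (- X) = - T X" for X using scl[of "-1" X] by simp
  show "T (X - Y) = T X - T Y" using add[of X "- Y"] neg by simp
  show "T (sum F A) = (\<Sum>i\<in>A. T (F i))"
    by (induction A rule: infinite_finite_induct) (auto simp: zero add)
qed

lemma local_linear_cong:
  assumes T: "local_linear T" and eq: "\<And>v. length v \<le> length w \<Longrightarrow> cf X v = cf Y v"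
  shows "cf (T X) w = cf (T Y) w"
proof -
  have "vanish (Suc (length w)) (X - Y)" using eq by (simp add: vanish_def less_Suc_eq_le)
  from local_linearD(3)[OF T this] show ?thesis
    by (simp add: local_linearD(6)[OF T] vanish_def)
qed

lemma local_linear_mult_left: "local_linear (\<lambda>X. A * X)"
  by (rule local_linearI) (use vanish_mult[of 0 A] in \<open>simp_all add: algebra_simps\<close>)

lemma local_linear_mult_right: "local_linear (\<lambda>X. X * A)"
  by (rule local_linearI) (use vanish_mult[of _ _ 0 A] in \<open>simp_all add: algebra_simps\<close>)

lemma local_linear_id: "local_linear (\<lambda>X. X)"
  by (rule local_linearI) simp_all

lemma local_linear_add: "local_linear S \<Longrightarrow> local_linear T \<Longrightarrow> local_linear (\<lambda>X. S X + T X)"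
  by (rule local_linearI) (simp_all add: local_linearD vanish_arith scl_distribs)

lemma local_linear_diff: "local_linear S \<Longrightarrow> local_linear T \<Longrightarrow> local_linear (\<lambda>X. S X - T X)"
  by (rule local_linearI) (simp_all add: local_linearD vanish_arith scl_distribs)

lemma local_linear_comp: "local_linear S \<Longrightarrow> local_linear T \<Longrightarrow> local_linear (\<lambda>X. S (T X))"
  by (rule local_linearI) (simp_all add: local_linearD)

section \<open>Monomials, and operators determined by their values on generators\<close>

definition lgen :: "gen \<Rightarrow> ser" where "lgen x = Ser (gen_s x)"

lemma cf_lgen: "cf (lgen x) w = (if w = [x] then 1 else 0)"
  by (simp add: lgen_def gen_s_def)

fun monom_s :: "gen list \<Rightarrow> ser" where
  "monom_s [] = 1"
| "monom_s (x # w) = lgen x * monom_s w"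

lemma hd_der_lgen: "hd_der y (lgen x) = (if x = y then 1 else 0)"
  by (rule ser_eqI) (simp add: cf_lgen cf_1)

lemma cf_monom_s: "cf (monom_s v) w = (if w = v then 1 else 0)"
proof (induction v arbitrary: w)
  case Nil
  then show ?case by (simp add: cf_1)
next
  case (Cons x v)
  then show ?case
    by (cases w) (auto simp: cf_mult_Cons hd_der_lgen cf_lgen)
qed

lemma finite_gen_UNIV: "finite (UNIV :: gen set)"
proof -
  have "(UNIV :: gen set) = {Ga, Gb, Ge, Gf, Gg}" using gen.exhaust by auto
  then show ?thesis by (metis finite.emptyI finite_insert)
qed

lemma finite_words: "finite {v :: gen list. length v \<le> n}"
  using finite_lists_length_le[OF finite_gen_UNIV, of n] by simp

text \<open>There are finitely many words of bounded length over a finite alphabet, so a truncated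
  series is a finite combination of monomials.\<close>

lemma local_linear_eqI:
  assumes S: "local_linear S" and T: "local_linear T" and eq: "\<And>v. S (monom_s v) = T (monom_s v)"
  shows "S X = T X"
proof (rule ser_eqI)
  fix w :: "gen list"
  let ?V = "{v :: gen list. length v \<le> length w}"
  define X' where "X' = (\<Sum>v\<in>?V. cf X v \<bullet> monom_s v)"
  have "cf X' u = cf X u" if "length u \<le> length w" for u
    using that finite_words[of "length w"]
    by (simp add: X'_def cf_monom_s sum.delta if_distrib[of "(*) _"] cong: if_cong)
  then have "cf (R X) w = cf (R X') w" if "local_linear R" for R
    using local_linear_cong[OF that, of w X X'] by simp
  moreover have "S X' = T X'"
    by (simp add: X'_def local_linearD[OF S] local_linearD[OF T] eq)
  ultimately show "cf (S X) w = cf (T X) w" using S T by simp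
qed

text \<open>Induction on monomials. The free choice of \<alpha> and \<beta> lets one statement serve
  composites \<open>D (D X)\<close>, parity defects, and differences
  \<open>D (S X) - S (D X)\<close> along a ring homomorphism S.\<close>

lemma skew_derivation_eq_0:
  assumes T: "local_linear T" and one: "T 1 = 0" and gens: "\<And>x. T (lgen x) = 0"
    and mult: "\<And>X Y. T (X * Y) = T X * \<alpha> Y + \<beta> X * T Y"
  shows "T X = 0"
proof -
  have "T (monom_s v) = 0" for v
    by (induction v) (simp_all add: one gens mult)
  moreover have "local_linear (\<lambda>X. 0)" by (rule local_linearI) (simp_all add: vanish_arith)
  ultimately show ?thesis using local_linear_eqI[OF T] by simp
qed

subsection \<open>Locally finite sums and functional calculus\<close>

text \<open>The cutoff at the word length copies the one in \<open>exp_s\<close> and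
  \<open>fps_ad\<close>. Under \<open>locfin\<close> the omitted terms vanish, so this is then the
  genuine infinite sum.\<close>

definition Ssum :: "(nat \<Rightarrow> ser) \<Rightarrow> ser" where
  "Ssum F = Ser (\<lambda>w. \<Sum>n\<le>length w. cf (F n) w)"

definition locfin :: "(nat \<Rightarrow> ser) \<Rightarrow> bool" where
  "locfin F \<longleftrightarrow> (\<forall>n. vanish n (F n))"

lemma cf_Ssum: "cf (Ssum F) w = (\<Sum>n\<le>length w. cf (F n) w)"
  by (simp add: Ssum_def)

lemma cf_Ssum_ge:
  assumes "locfin F" "length w \<le> N"
  shows "cf (Ssum F) w = (\<Sum>n\<le>N. cf (F n) w)"
  unfolding cf_Ssum
  using assms by (intro sum.mono_neutral_left) (auto simp: locfin_def vanish_def)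

lemma local_linear_Ssum:
  assumes T: "local_linear T" and F: "locfin F"
  shows "T (Ssum F) = Ssum (\<lambda>n. T (F n))"
proof (rule ser_eqI)
  fix w
  have "cf (T (Ssum F)) w = cf (T (\<Sum>n\<le>length w. F n)) w"
    using F by (intro local_linear_cong[OF T]) (simp add: cf_Ssum_ge)
  then show "cf (T (Ssum F)) w = cf (Ssum (\<lambda>n. T (F n))) w"
    by (simp add: local_linearD[OF T] cf_Ssum)
qed

lemma sum_square_triangle:
  fixes f :: "nat \<Rightarrow> nat \<Rightarrow> 'a::comm_monoid_add"
  assumes "\<And>i j. N < i + j \<Longrightarrow> f i j = 0"
  shows "(\<Sum>i\<le>N. \<Sum>j\<le>N. f i j) = (\<Sum>k\<le>N. \<Sum>i\<le>k. f i (k - i))"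
proof -
  have "(\<Sum>i\<le>N. \<Sum>j\<le>N. f i j) = (\<Sum>(i, j)\<in>{..N} \<times> {..N}. f i j)"
    by (simp add: sum.cartesian_product)
  also have "\<dots> = (\<Sum>(i, j)\<in>{(i, j). i + j \<le> N}. f i j)"
    by (intro sum.mono_neutral_right) (auto simp: not_le intro!: assms)
  finally show ?thesis by (simp add: sum.triangle_reindex_eq)
qed

lemma Ssum_mult:
  assumes F: "locfin F" and G: "locfin G"
  shows "Ssum F * Ssum G = Ssum (\<lambda>n. \<Sum>k\<le>n. F k * G (n - k))"
proof (rule ser_eqI)
  fix w
  have "cf (F i * G j) w = 0" if "length w < i + j" for i j
    using vanish_mult[of i "F i" j "G j"] F G that by (simp add: locfin_def vanish_def)
  then have "(\<Sum>i\<le>length w. \<Sum>j\<le>length w. cf (F i * G j) w)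
      = (\<Sum>k\<le>length w. \<Sum>i\<le>k. cf (F i * G (k - i)) w)"
    by (rule sum_square_triangle)
  moreover have "F i * Ssum G = Ssum (\<lambda>j. F i * G j)" for i
    by (rule local_linear_Ssum[OF local_linear_mult_left G])
  moreover have "Ssum F * Ssum G = Ssum (\<lambda>i. F i * Ssum G)"
    by (rule local_linear_Ssum[OF local_linear_mult_right F])
  ultimately show "cf (Ssum F * Ssum G) w = cf (Ssum (\<lambda>n. \<Sum>k\<le>n. F k * G (n - k))) w"
    by (simp add: cf_Ssum)
qed

text \<open>The n-th power of such an operator produces only words of length at least n, so every
  power series in it converges.\<close>

definition contracting :: "(ser \<Rightarrow> ser) \<Rightarrow> bool" where
  "contracting T \<longleftrightarrow> local_linear T \<and> (\<forall>n X. vanish n X \<longrightarrow> vanish (Suc n) (T X))"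

definition fop :: "rat fps \<Rightarrow> (ser \<Rightarrow> ser) \<Rightarrow> ser \<Rightarrow> ser" where
  "fop \<phi> T X = Ssum (\<lambda>n. fps_nth \<phi> n \<bullet> (T ^^ n) X)"

lemma local_linear_funpow: "local_linear T \<Longrightarrow> local_linear (T ^^ n)"
proof (induction n)
  case (Suc n)
  then show ?case using local_linear_comp[of T "T ^^ n"] by (simp add: comp_def)
qed (simp add: local_linear_id id_def)

lemma contracting_funpow: "contracting T \<Longrightarrow> vanish m X \<Longrightarrow> vanish (n + m) ((T ^^ n) X)"
  by (induction n) (auto simp: contracting_def)

lemma contracting_locfin: "contracting T \<Longrightarrow> locfin (\<lambda>n. fps_nth \<phi> n \<bullet> (T ^^ n) X)"
  using contracting_funpow[of T 0 X] by (simp add: locfin_def vanish_arith)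

text \<open>Terms with n + m beyond the word length vanish, which turns the square of indices into
  the triangle of the Cauchy product.\<close>

lemma fop_mult:
  assumes T: "contracting T"
  shows "fop (\<phi> * \<psi>) T X = fop \<phi> T (fop \<psi> T X)"
proof (rule ser_eqI)
  fix w
  have "(T ^^ n) (fop \<psi> T X) = Ssum (\<lambda>m. (T ^^ n) (fps_nth \<psi> m \<bullet> (T ^^ m) X))" for n
    unfolding fop_def using T
    by (intro local_linear_Ssum contracting_locfin local_linear_funpow) (auto simp: contracting_def)
  also have "\<dots> n = Ssum (\<lambda>m. fps_nth \<psi> m \<bullet> (T ^^ (n + m)) X)" for n
    using T local_linear_funpow[of T n]
    by (simp add: local_linearD(2) contracting_def funpow_add)
  finally have 1: "cf (fop \<phi> T (fop \<psi> T X)) w = (\<Sum>n\<le>length w. \<Sum>m\<le>length w.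
      fps_nth \<phi> n * fps_nth \<psi> m * cf ((T ^^ (n + m)) X) w)"
    by (simp add: fop_def cf_Ssum sum_distrib_left mult.assoc)
  have 2: "cf ((T ^^ k) X) w = 0" if "length w < k" for k
    using contracting_funpow[OF T, of 0 X k] that by (simp add: vanish_def)
  show "cf (fop (\<phi> * \<psi>) T X) w = cf (fop \<phi> T (fop \<psi> T X)) w"
    unfolding 1
    by (subst sum_square_triangle)
       (auto simp: 2 fop_def cf_Ssum fps_mult_nth sum_distrib_right atLeast0AtMost intro!: sum.cong)
qed

lemma fop_add: "fop (\<phi> + \<psi>) T X = fop \<phi> T X + fop \<psi> T X"
  by (rule ser_eqI) (simp add: fop_def cf_Ssum algebra_simps sum.distrib)

lemma fop_uminus: "fop (- \<phi>) T X = - fop \<phi> T X"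
  by (rule ser_eqI) (simp add: fop_def cf_Ssum sum_negf)

lemma fop_const: "fop (fps_const c) T X = c \<bullet> X"
proof (rule ser_eqI)
  fix w
  have "(\<Sum>n\<le>length w. (if n = 0 then c else 0) * cf ((T ^^ n) X) w)
      = (\<Sum>n\<le>length w. if n = 0 then c * cf X w else 0)"
    by (intro sum.cong) auto
  then show "cf (fop (fps_const c) T X) w = cf (c \<bullet> X) w"
    by (simp add: fop_def cf_Ssum)
qed

lemma fop_1: "fop 1 T X = X"
  using fop_const[of 1 T X] by simp

lemma fop_X: 
  assumes "contracting T"
  shows "fop fps_X T X = T X"
proof (rule ser_eqI)
  fix w
  \<comment> \<open>At the empty word the defining range stops at n = 0; it is enlarged so that the
    term n = 1 is present for every word.\<close>
  have "cf (fop fps_X T X) w = (\<Sum>n\<le>Suc (length w). cf (fps_nth fps_X n \<bullet> (T ^^ n) X) w)"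
    unfolding fop_def by (rule cf_Ssum_ge[OF contracting_locfin[OF assms]]) simp
  also have "\<dots> = (\<Sum>n\<le>Suc (length w). if n = 1 then cf (T X) w else 0)"
    by (intro sum.cong) (auto simp: fps_X_def)
  finally show "cf (fop fps_X T X) w = cf (T X) w" by (simp add: sum.delta del: sum.atMost_Suc)
qed

lemma local_linear_fop:
  assumes S: "local_linear S" and T: "contracting T" and ST: "\<And>X. S (T X) = T' (S X)"
  shows "S (fop \<phi> T X) = fop \<phi> T' (S X)"
proof -
  have "S ((T ^^ n) X) = (T' ^^ n) (S X)" for n by (induction n) (simp_all add: ST)
  then show ?thesis
    unfolding fop_def
    by (subst local_linear_Ssum[OF S contracting_locfin[OF T]]) (simp add: local_linearD[OF S])
qed

lemma contracting_mult_left: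
  assumes "cf X [] = 0"
  shows "contracting (\<lambda>Y. X * Y)"
  using vanish_mult[of "Suc 0" X] assms
  by (simp add: contracting_def local_linear_mult_left vanish_1)

definition comm :: "ser \<Rightarrow> ser \<Rightarrow> ser" where "comm X Y = X * Y - Y * X"

lemma contracting_comm:
  assumes "cf X [] = 0"
  shows "contracting (comm X)"
  using vanish_mult[of "Suc 0" X] vanish_mult[of _ _ "Suc 0" X] assms
  unfolding contracting_def comm_def
  by (auto simp: vanish_1 vanish_arith intro!: local_linear_diff local_linear_mult_left local_linear_mult_right)

definition fev :: "rat fps \<Rightarrow> ser \<Rightarrow> ser" where
  "fev \<phi> X = Ssum (\<lambda>n. fps_nth \<phi> n \<bullet> X ^ n)"

lemma fev_eq_fop: "fev \<phi> X = fop \<phi> (\<lambda>Y. X * Y) 1"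
proof -
  have "((\<lambda>Y. X * Y) ^^ n) 1 = X ^ n" for n by (induction n) simp_all
  then show ?thesis by (simp add: fev_def fop_def)
qed

lemma locfin_fev: "cf X [] = 0 \<Longrightarrow> locfin (\<lambda>n. fps_nth \<phi> n \<bullet> X ^ n)"
  by (simp add: locfin_def vanish_arith vanish_power)

lemma fev_mult:
  assumes "cf X [] = 0"
  shows "fev (\<phi> * \<psi>) X = fev \<phi> X * fev \<psi> X"
proof -
  have "fev \<phi> X * fev \<psi> X
      = Ssum (\<lambda>n. \<Sum>k\<le>n. (fps_nth \<phi> k \<bullet> X ^ k) * (fps_nth \<psi> (n - k) \<bullet> X ^ (n - k)))"
    unfolding fev_def by (intro Ssum_mult locfin_fev assms)
  also have "(\<lambda>n. \<Sum>k\<le>n. (fps_nth \<phi> k \<bullet> X ^ k) * (fps_nth \<psi> (n - k) \<bullet> X ^ (n - k)))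
      = (\<lambda>n. fps_nth (\<phi> * \<psi>) n \<bullet> X ^ n)"
  proof
    fix n
    have "(\<Sum>k\<le>n. (fps_nth \<phi> k \<bullet> X ^ k) * (fps_nth \<psi> (n - k) \<bullet> X ^ (n - k)))
        = (\<Sum>k\<le>n. (fps_nth \<phi> k * fps_nth \<psi> (n - k)) \<bullet> X ^ n)"
      by (intro sum.cong) (simp_all add: power_add[symmetric] mult.commute)
    then show "(\<Sum>k\<le>n. (fps_nth \<phi> k \<bullet> X ^ k) * (fps_nth \<psi> (n - k) \<bullet> X ^ (n - k)))
        = fps_nth (\<phi> * \<psi>) n \<bullet> X ^ n"
      by (intro ser_eqI) (simp add: fps_mult_nth sum_distrib_right atLeast0AtMost)
  qed
  finally show ?thesis by (simp add: fev_def)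
qed

lemma fev_1 [simp]: "fev 1 X = 1"
  by (simp add: fev_eq_fop fop_1)

lemma fev_X [simp]: "cf X [] = 0 \<Longrightarrow> fev fps_X X = X"
  by (simp add: fev_eq_fop fop_X contracting_mult_left)

lemma fev_diff: "fev (\<phi> - \<psi>) X = fev \<phi> X - fev \<psi> X"
  using fop_add[of \<phi> "- \<psi>"] by (simp add: fev_eq_fop fop_uminus)

lemma fev_power: "cf X [] = 0 \<Longrightarrow> fev (\<phi> ^ n) X = fev \<phi> X ^ n"
  by (induction n) (simp_all add: fev_mult)

lemma cf_fev_Nil [simp]: "cf (fev \<phi> X) [] = fps_nth \<phi> 0"
  by (simp add: fev_def cf_Ssum cf_1)

lemma cf_fev_single: "cf X [] = 0 \<Longrightarrow> cf (fev \<phi> X) [y] = fps_nth \<phi> 1 * cf X [y]"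
  by (simp add: fev_def cf_Ssum cf_1)

text \<open>The power \<open>\<psi> ^ i\<close> starts in degree i, so after exchanging the
  summations only i \<le> n survives. This is what makes \<open>slog\<close> and \<open>sexp\<close>
  mutually inverse.\<close>

lemma fev_compose:
  assumes X: "cf X [] = 0" and \<psi>: "fps_nth \<psi> 0 = 0"
  shows "fev (\<phi> oo \<psi>) X = fev \<phi> (fev \<psi> X)"
proof (rule ser_eqI)
  fix w :: "gen list"
  let ?N = "length w"
  have 0: "fps_nth (\<psi> ^ i) n = 0" if "n < i" for i n
    using startsby_zero_power_prefix[OF \<psi>] that by blast
  have "cf (fev \<phi> (fev \<psi> X)) w = (\<Sum>i\<le>?N. fps_nth \<phi> i * cf (fev (\<psi> ^ i) X) w)"
    by (simp add: fev_def[of \<phi>] cf_Ssum fev_power[OF X])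
  also have "\<dots> = (\<Sum>i\<le>?N. \<Sum>n\<le>?N. fps_nth \<phi> i * (fps_nth (\<psi> ^ i) n * cf (X ^ n) w))"
    by (simp add: fev_def cf_Ssum sum_distrib_left)
  also have "\<dots> = (\<Sum>n\<le>?N. \<Sum>i\<le>?N. fps_nth \<phi> i * (fps_nth (\<psi> ^ i) n * cf (X ^ n) w))"
    by (rule sum.swap)
  also have "\<dots> = (\<Sum>n\<le>?N. \<Sum>i\<le>n. fps_nth \<phi> i * (fps_nth (\<psi> ^ i) n * cf (X ^ n) w))"
    by (intro sum.cong refl sum.mono_neutral_right) (auto simp: 0)
  also have "\<dots> = cf (fev (\<phi> oo \<psi>) X) w"
    by (simp add: fev_def cf_Ssum fps_compose_nth sum_distrib_right atLeast0AtMost mult.assoc)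
  finally show "cf (fev (\<phi> oo \<psi>) X) w = cf (fev \<phi> (fev \<psi> X)) w" by simp
qed

lemma ring_hom_fev:
  assumes S: "local_linear S" "S 1 = 1" "\<And>X Y. S (X * Y) = S X * S Y" and X: "cf X [] = 0"
  shows "S (fev \<phi> X) = fev \<phi> (S X)"
  unfolding fev_eq_fop
  using local_linear_fop[OF S(1) contracting_mult_left[OF X], of "\<lambda>Y. S X * Y" \<phi> 1] S by simp

text \<open>Induction kills all powers of X. With the logarithm series this transfers vanishing from
  an exponential to its exponent.\<close>

lemma twisted_derivation_fev_eq_0:
  assumes D: "local_linear D" and mult: "\<And>Y. D (X * Y) = D X * \<alpha> Y + \<beta> X * D Y"
    and 0: "D 1 = 0" "D X = 0" "cf X [] = 0"
  shows "D (fev \<phi> X) = 0"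
proof -
  have "D (X ^ n) = 0" for n by (induction n) (simp_all add: 0 mult)
  then have "D (fev \<phi> X) = Ssum (\<lambda>n. 0)"
    unfolding fev_def by (simp add: local_linear_Ssum[OF D locfin_fev[OF 0(3)]] local_linearD[OF D])
  also have "\<dots> = 0" by (rule ser_eqI) (simp add: cf_Ssum)
  finally show ?thesis .
qed

section \<open>Exponential and logarithm\<close>

definition sexp :: "ser \<Rightarrow> ser" where "sexp X = fev (fps_exp 1) X"
definition slog :: "ser \<Rightarrow> ser" where "slog X = fev (fps_ln 1) (X - 1)"

lemma sexp_Nil [simp]: "cf (sexp X) [] = 1"
  by (simp add: sexp_def)

lemma slog_Nil [simp]: "cf (slog X) [] = 0"
  by (simp add: slog_def)

lemma slog_sexp:
  assumes "cf X [] = 0"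
  shows "slog (sexp X) = X"
proof -
  have "sexp X - 1 = fev (fps_exp 1 - 1) X" by (simp add: sexp_def fev_diff)
  moreover have "fps_ln 1 oo (fps_exp 1 - 1) = (fps_X :: rat fps)"
    by (simp add: fps_ln_fps_exp_inv fps_inv)
  ultimately show ?thesis
    using fev_compose[OF assms, of "fps_exp 1 - 1" "fps_ln 1"] assms by (simp add: slog_def)
qed

lemma sexp_slog:
  assumes "cf G [] = 1"
  shows "sexp (slog G) = G"
proof -
  have 0: "cf (G - 1) [] = 0" using assms by (simp add: cf_1)
  have "(fps_exp 1 - 1) oo fps_ln 1 = (fps_X :: rat fps)"
    by (simp add: fps_ln_fps_exp_inv fps_inv_right)
  then have "fev (fps_exp 1 - 1) (slog G) = G - 1"
    using fev_compose[OF 0, of "fps_ln 1" "fps_exp 1 - 1"] 0 by (simp add: slog_def)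
  then show ?thesis by (simp add: sexp_def fev_diff)
qed

lemma sexp_scl: "sexp (c \<bullet> X) = fev (fps_exp c) X"
  by (simp add: sexp_def fev_def power_scl mult.commute)

lemma sexp_scl_mult:
  assumes "cf X [] = 0"
  shows "sexp (c \<bullet> X) * sexp (d \<bullet> X) = sexp ((c + d) \<bullet> X)"
  by (simp add: sexp_scl fev_mult[OF assms, symmetric] fps_exp_add_mult)

lemma sexp_0 [simp]: "sexp 0 = 1"
  using sexp_scl[of 0 0] by simp

lemma sexp_inverse:
  assumes "cf X [] = 0"
  shows "sexp X * sexp (- X) = 1" "sexp (- X) * sexp X = 1"
  using sexp_scl_mult[OF assms, of 1 "-1"] sexp_scl_mult[OF assms, of "-1" 1] by simp_all

subsection \<open>The differential of the exponential map\<close>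

text \<open>The series (1 - exp(-t)) / t, which evaluated at ad_Z turns D Z into exp(-Z) D(exp
  Z).\<close>

definition psi :: "rat fps" where "psi = Abs_fps (\<lambda>k. (- 1) ^ k / fact (Suc k))"

text \<open>Right multiplication by Z is left multiplication minus ad_Z, and these two commute: this
  is the binomial theorem for their difference.\<close>

lemma mult_power_comm:
  "X * Z ^ n = (\<Sum>k\<le>n. (of_nat (n choose k) * (- 1) ^ k) \<bullet> (Z ^ (n - k) * (comm Z ^^ k) X))"
proof (induction n arbitrary: X)
  case (Suc n)
  let ?t = "\<lambda>m k c. (of_nat c * (- 1) ^ k) \<bullet> (Z ^ (m - k) * (comm Z ^^ k) X)"
  have a: "comm Z ((comm Z ^^ k) X) = (comm Z ^^ k) (comm Z X)" for k
    by (simp add: funpow_swap1)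
  have "X * Z ^ Suc n = Z * (X * Z ^ n) - comm Z X * Z ^ n"
    by (simp add: comm_def algebra_simps)
  also have "Z * (X * Z ^ n) = (\<Sum>k\<le>n. ?t (Suc n) k (n choose k))"
    unfolding Suc.IH[of X] sum_distrib_left
    by (intro sum.cong) (simp_all add: Suc_diff_le mult.assoc)
  \<comment> \<open>The added term has binomial coefficient zero; after splitting off k = 0 the two
    sums combine by Pascal's rule.\<close>
  also have "\<dots> = (\<Sum>k\<le>Suc n. ?t (Suc n) k (n choose k))" by (simp add: binomial_eq_0)
  also have "\<dots> = ?t (Suc n) 0 1 + (\<Sum>k\<le>n. ?t (Suc n) (Suc k) (n choose Suc k))"
    by (simp add: sum.atMost_Suc_shift del: sum.atMost_Suc)
  also have "comm Z X * Z ^ n = - (\<Sum>k\<le>n. ?t (Suc n) (Suc k) (n choose k))"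
    unfolding Suc.IH[of "comm Z X"] by (simp add: sum_negf a)
  also have "?t (Suc n) 0 1 + (\<Sum>k\<le>n. ?t (Suc n) (Suc k) (n choose Suc k))
      - - (\<Sum>k\<le>n. ?t (Suc n) (Suc k) (n choose k))
    = ?t (Suc n) 0 1 + (\<Sum>k\<le>n. ?t (Suc n) (Suc k) (Suc n choose Suc k))"
  proof -
    have "(\<Sum>k\<le>n. ?t (Suc n) (Suc k) (n choose Suc k)) + (\<Sum>k\<le>n. ?t (Suc n) (Suc k) (n choose k))
        = (\<Sum>k\<le>n. ?t (Suc n) (Suc k) (Suc n choose Suc k))"
      unfolding sum.distrib[symmetric]
      by (intro sum.cong refl ser_eqI) (simp add: algebra_simps)
    then show ?thesis by (simp only: diff_minus_eq_add add.assoc)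
  qed
  also have "\<dots> = (\<Sum>k\<le>Suc n. ?t (Suc n) k (Suc n choose k))"
    by (simp add: sum.atMost_Suc_shift del: sum.atMost_Suc binomial_Suc_Suc)
  finally show ?case .
qed simp

text \<open>The Leibniz rule is asked only for products with Z on the left, so an odd derivation
  qualifies when Z is even.\<close>

lemma derivation_power_comm:
  assumes mult: "\<And>X. D (Z * X) = D Z * X + Z * D X" and one: "D 1 = 0"
  shows "D (Z ^ Suc n) = (\<Sum>k\<le>n. (of_nat (Suc n choose Suc k) * (- 1) ^ k)
      \<bullet> (Z ^ (n - k) * (comm Z ^^ k) (D Z)))"
proof (induction n)
  case 0
  then show ?case using mult[of 1] one by simp
next
  case (Suc n)
  let ?t = "\<lambda>m k c. (of_nat c * (- 1) ^ k) \<bullet> (Z ^ (m - k) * (comm Z ^^ k) (D Z))"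
  have "D (Z ^ Suc (Suc n)) = D Z * Z ^ Suc n + Z * D (Z ^ Suc n)"
    using mult[of "Z ^ Suc n"] by simp
  also have "D Z * Z ^ Suc n = (\<Sum>k\<le>Suc n. ?t (Suc n) k (Suc n choose k))"
    by (rule mult_power_comm)
  also have "Z * D (Z ^ Suc n) = (\<Sum>k\<le>n. ?t (Suc n) k (Suc n choose Suc k))"
    unfolding Suc.IH sum_distrib_left
    by (intro sum.cong) (simp_all add: Suc_diff_le mult.assoc)
  also have "\<dots> = (\<Sum>k\<le>Suc n. ?t (Suc n) k (Suc n choose Suc k))" by (simp add: binomial_eq_0)
  also have "(\<Sum>k\<le>Suc n. ?t (Suc n) k (Suc n choose k)) + (\<Sum>k\<le>Suc n. ?t (Suc n) k (Suc n choose Suc k))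
     = (\<Sum>k\<le>Suc n. ?t (Suc n) k (Suc (Suc n) choose Suc k))"
    unfolding sum.distrib[symmetric]
    by (intro sum.cong) (simp_all add: binomial_Suc_Suc scl_distribs distrib_right del: power_Suc)
  finally show ?case .
qed

lemma sexp_mult_fop_comm:
  assumes "cf Z [] = 0"
  shows "sexp Z * fop \<phi> (comm Z) X
    = Ssum (\<lambda>n. \<Sum>k\<le>n. (1 / fact (n - k) * fps_nth \<phi> k) \<bullet> (Z ^ (n - k) * (comm Z ^^ k) X))"
proof -
  have "sexp Z * fop \<phi> (comm Z) X = Ssum (\<lambda>n. \<Sum>k\<le>n. (fps_nth (fps_exp 1) k \<bullet> Z ^ k)
      * (fps_nth \<phi> (n - k) \<bullet> (comm Z ^^ (n - k)) X))"
    unfolding sexp_def fev_def fop_def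
    by (intro Ssum_mult locfin_fev contracting_locfin contracting_comm assms)
  also have "\<dots> = Ssum (\<lambda>n. \<Sum>k\<le>n. (1 / fact (n - k) * fps_nth \<phi> k) \<bullet> (Z ^ (n - k) * (comm Z ^^ k) X))"
  proof (intro arg_cong[where f = Ssum] ext)
    fix n
    show "(\<Sum>k\<le>n. (fps_nth (fps_exp 1) k \<bullet> Z ^ k) * (fps_nth \<phi> (n - k) \<bullet> (comm Z ^^ (n - k)) X))
      = (\<Sum>k\<le>n. (1 / fact (n - k) * fps_nth \<phi> k) \<bullet> (Z ^ (n - k) * (comm Z ^^ k) X))"
      by (subst sum.nat_diff_reindex[symmetric, of _ "Suc n", simplified lessThan_Suc_atMost])
         (intro sum.cong; simp add: mult.commute)
  qed
  finally show ?thesis .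
qed

text \<open>Dividing the formula for X Z^n by n! leaves 1/(n-k)! and (-1)^k/k!, the coefficients of
  exp(t) and exp(-t). So exp(-Z) X exp(Z) is exp(-ad_Z) applied to X.\<close>

lemma mult_sexp:
  assumes Z: "cf Z [] = 0"
  shows "X * sexp Z = sexp Z * fop (fps_exp (- 1)) (comm Z) X"
proof -
  have "X * sexp Z = Ssum (\<lambda>n. (1 / fact n) \<bullet> (X * Z ^ n))"
    unfolding sexp_def fev_def
    by (subst local_linear_Ssum[OF local_linear_mult_left locfin_fev[OF Z]]) simp
  also have "(\<lambda>n. (1 / fact n) \<bullet> (X * Z ^ n)) = (\<lambda>n. \<Sum>k\<le>n.
      (1 / fact (n - k) * fps_nth (fps_exp (- 1)) k) \<bullet> (Z ^ (n - k) * (comm Z ^^ k) X))"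
    unfolding mult_power_comm scl_sum
    by (intro ext sum.cong) (simp_all add: binomial_fact field_simps)
  finally show ?thesis by (simp add: sexp_mult_fop_comm[OF Z])
qed

text \<open>The binomial coefficient of k+1 in n+1, divided by (n+1)!, splits as 1/(n-k)! times
  1/(k+1)!; the second factor with its sign is the coefficient of \<open>psi\<close>.\<close>

lemma derivation_sexp:
  assumes D: "local_linear D" and mult: "\<And>X. D (Z * X) = D Z * X + Z * D X" and one: "D 1 = 0"
    and Z: "cf Z [] = 0"
  shows "D (sexp Z) = sexp Z * fop psi (comm Z) (D Z)"
proof -
  have lf: "locfin (\<lambda>n. (1 / fact n) \<bullet> D (Z ^ n))"
    unfolding locfin_def by (intro allI vanish_arith local_linearD(3)[OF D] vanish_power Z)
  have "D (sexp Z) = Ssum (\<lambda>n. (1 / fact n) \<bullet> D (Z ^ n))"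
    unfolding sexp_def fev_def
    by (subst local_linear_Ssum[OF D locfin_fev[OF Z]]) (simp add: local_linearD[OF D])
  \<comment> \<open>The term n = 0 drops out because \<open>D 1 = 0\<close>; local finiteness
    supplies the extra term needed for the shift.\<close>
  also have "\<dots> = Ssum (\<lambda>n. (1 / fact (Suc n)) \<bullet> D (Z ^ Suc n))"
  proof (rule ser_eqI)
    fix w
    have "cf (Ssum (\<lambda>n. (1 / fact n) \<bullet> D (Z ^ n))) w
        = (\<Sum>n\<le>Suc (length w). cf ((1 / fact n) \<bullet> D (Z ^ n)) w)"
      by (rule cf_Ssum_ge[OF lf]) simp
    then show "cf (Ssum (\<lambda>n. (1 / fact n) \<bullet> D (Z ^ n))) w
        = cf (Ssum (\<lambda>n. (1 / fact (Suc n)) \<bullet> D (Z ^ Suc n))) w"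
      by (simp add: cf_Ssum sum.atMost_Suc_shift one del: sum.atMost_Suc fact_Suc power_Suc)
  qed
  also have "(\<lambda>n. (1 / fact (Suc n)) \<bullet> D (Z ^ Suc n)) = (\<lambda>n. \<Sum>k\<le>n.
      (1 / fact (n - k) * fps_nth psi k) \<bullet> (Z ^ (n - k) * (comm Z ^^ k) (D Z)))"
    unfolding derivation_power_comm[of D, OF mult one] scl_sum
    by (intro ext sum.cong) (simp_all add: binomial_fact psi_def field_simps del: fact_Suc binomial_Suc_Suc)
  finally show ?thesis by (simp add: sexp_mult_fop_comm[OF Z])
qed

section \<open>Power series identities relating \<open>psi\<close>, \<open>phi1\<close> and
  \<open>phi2\<close>\<close>

lemma psi_X: "fps_X * psi = 1 - fps_exp (- 1)"
proof (rule fps_ext)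
  fix n show "fps_nth (fps_X * psi) n = fps_nth (1 - fps_exp (- 1)) n"
    by (cases n) (simp_all add: psi_def del: fact_Suc)
qed

text \<open>The subdegree is 1, as for \<open>fps_X\<close>; this makes \<open>div\<close> in
  \<open>phi1\<close> and \<open>phi2\<close> an exact quotient.\<close>

lemma one_minus_fps_exp_dvd:
  assumes "c \<noteq> (0 :: rat)"
  shows "1 - fps_exp c dvd fps_X" "1 - fps_exp c \<noteq> 0"
proof -
  have "subdegree (1 - fps_exp c) = 1"
    using assms by (intro subdegreeI) auto
  moreover from this show "1 - fps_exp c \<noteq> 0" by auto
  ultimately show "1 - fps_exp c dvd fps_X" by (simp add: fps_dvd_iff)
qed

lemma phi1_mult: "phi1 * (1 - fps_exp 1) = fps_X"
  unfolding phi1_def by (rule dvd_div_mult_self[OF one_minus_fps_exp_dvd(1)]) simp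

lemma phi2_mult: "phi2 * (1 - fps_exp (- 1)) = fps_X"
  unfolding phi2_def by (rule dvd_div_mult_self[OF one_minus_fps_exp_dvd(1)]) simp

lemma psi_phi2: "psi * phi2 = 1"
proof -
  have "(1 - fps_exp (- 1)) * (psi * phi2) = (1 - fps_exp (- 1)) * (1 :: rat fps)"
    using phi2_mult psi_X by (metis mult.assoc mult.commute mult.right_neutral)
  then show ?thesis using one_minus_fps_exp_dvd(2)[of "-1"] by (simp del: mult_1_right)
qed

text \<open>The quotient of 1 - exp(-t) by 1 - exp(t) is -exp(-t); the proof multiplies by the
  nonzero series t (1 - exp(t)) and cancels it.\<close>

lemma psi_phi1: "psi * phi1 = - fps_exp (- 1)"
proof -
  have e: "fps_exp (- 1) * fps_exp 1 = (1 :: rat fps)"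
    by (simp add: fps_exp_add_mult[symmetric])
  have "fps_X * (1 - fps_exp 1) * (psi * phi1) = (fps_X * psi) * (phi1 * (1 - fps_exp 1))"
    by (simp add: mult_ac)
  also have "\<dots> = fps_X * (1 - fps_exp 1) * (- fps_exp (- 1))"
    unfolding psi_X phi1_mult using e by (simp add: algebra_simps)
  finally have "fps_X * (1 - fps_exp 1) * (psi * phi1) = fps_X * (1 - fps_exp 1) * (- fps_exp (- 1))" .
  moreover have "fps_X * (1 - fps_exp 1) \<noteq> (0 :: rat fps)"
    using one_minus_fps_exp_dvd(2)[of 1] by simp
  ultimately show ?thesis by (metis mult_left_cancel)
qed

subsection \<open>Parity, grading and the graded commutator\<close>

lemma wdeg_append [simp]: "wdeg (u @ v) = wdeg u + wdeg v"
  by (simp add: wdeg_def)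

lemma wsign_append [simp]: "wsign (u @ v) = wsign u * wsign v"
  by (simp add: wsign_def power_add)

lemma wsign_Nil [simp]: "wsign [] = 1"
  by (simp add: wsign_def)

lemma wsign_conv_wdeg: "wsign w = (if odd (wdeg w) then - 1 else 1)"
  by (induction w) (auto simp: wsign_def wdeg_def)

lemma wsign_take_drop: "wsign (take i w) * wsign (drop i w) = wsign w"
  by (metis append_take_drop_id wsign_append)

text \<open>The parity automorphism. It absorbs the Koszul sign, so the graded Leibniz rule can be
  stated for all series, homogeneous or not.\<close>

definition eps :: "ser \<Rightarrow> ser" where "eps X = Ser (\<lambda>w. wsign w * cf X w)"

lemma cf_eps [simp]: "cf (eps X) w = wsign w * cf X w"
  by (simp add: eps_def)

lemma eps_mult [simp]: "eps (X * Y) = eps X * eps Y"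
proof (rule ser_eqI)
  fix w
  have "wsign w * (cf X (take i w) * cf Y (drop i w))
      = wsign (take i w) * cf X (take i w) * (wsign (drop i w) * cf Y (drop i w))" for i
    by (subst wsign_take_drop[of i, symmetric]) (simp add: mult_ac)
  then show "cf (eps (X * Y)) w = cf (eps X * eps Y) w"
    unfolding cf_mult cf_eps sum_distrib_left by presburger
qed

lemma local_linear_eps: "local_linear eps"
  by (rule local_linearI) (auto intro!: ser_eqI simp: algebra_simps vanish_def)

lemmas eps_linear [simp] = local_linearD(1,2,4-7)[OF local_linear_eps]

lemma eps_eps [simp]: "eps (eps X) = X"
  by (rule ser_eqI) (simp add: wsign_conv_wdeg)

lemma eps_1 [simp]: "eps 1 = 1"
  by (rule ser_eqI) (simp add: cf_1)

lemma eps_lgen: "eps (lgen x) = wsign [x] \<bullet> lgen x"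
  by (rule ser_eqI) (simp add: cf_lgen)

text \<open>The set P records which letters may occur, so degree and absence of \<open>Gg\<close>
  are tracked together.\<close>

definition graded :: "gen set \<Rightarrow> int \<Rightarrow> ser \<Rightarrow> bool" where
  "graded P d X \<longleftrightarrow> (\<forall>w. cf X w \<noteq> 0 \<longrightarrow> wdeg w = d \<and> set w \<subseteq> P)"

lemma graded_iff: "graded P d X \<longleftrightarrow> (\<forall>w. \<not> (wdeg w = d \<and> set w \<subseteq> P) \<longrightarrow> cf X w = 0)"
  unfolding graded_def by blast

lemma graded_arith:
  "graded P d 0" "graded P d X \<Longrightarrow> graded P d Y \<Longrightarrow> graded P d (X + Y)"
  "graded P d X \<Longrightarrow> graded P d Y \<Longrightarrow> graded P d (X - Y)" "graded P d X \<Longrightarrow> graded P d (- X)"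
  "graded P d X \<Longrightarrow> graded P d (c \<bullet> X)" "graded P d X \<Longrightarrow> graded P d (eps X)"
  unfolding graded_iff by simp_all

lemma graded_1: "graded P 0 1"
  by (auto simp: graded_def cf_1 wdeg_def)

lemma graded_lgen: "x \<in> P \<Longrightarrow> graded P (gdeg x) (lgen x)"
  by (auto simp: graded_def cf_lgen wdeg_def)

lemma graded_Ssum: "(\<And>n. graded P d (F n)) \<Longrightarrow> graded P d (Ssum F)"
  unfolding graded_def cf_Ssum by (metis (no_types, lifting) sum.neutral)

lemma graded_mult:
  assumes "graded P c X" "graded P d Y"
  shows "graded P (c + d) (X * Y)"
  unfolding graded_def
proof (intro allI impI)
  fix w assume "cf (X * Y) w \<noteq> 0"
  then obtain i where "cf X (take i w) * cf Y (drop i w) \<noteq> 0"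
    unfolding cf_mult by (meson sum.neutral)
  with assms have "wdeg (take i w) = c" "set (take i w) \<subseteq> P" "wdeg (drop i w) = d" "set (drop i w) \<subseteq> P"
    by (auto simp: graded_def)
  then show "wdeg w = c + d \<and> set w \<subseteq> P"
    by (metis append_take_drop_id le_sup_iff set_append wdeg_append)
qed

lemma graded_power: "graded P 0 X \<Longrightarrow> graded P 0 (X ^ n)"
  by (induction n) (use graded_mult[of P 0 X 0] in \<open>auto simp: graded_1\<close>)

lemma graded_fev: "graded P 0 X \<Longrightarrow> graded P 0 (fev \<phi> X)"
  unfolding fev_def by (intro graded_Ssum graded_arith graded_power)

lemma graded_comm_funpow:
  assumes "graded P 0 Z" "graded P d X"
  shows "graded P d ((comm Z ^^ n) X)"
proof (induction n)
  case (Suc n)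
  then show ?case
    using graded_mult[of P 0 Z d] graded_mult[of P d _ 0 Z] assms(1)
    by (auto simp: comm_def intro!: graded_arith)
qed (simp add: assms)

lemma graded_fop_comm: "graded P 0 Z \<Longrightarrow> graded P d X \<Longrightarrow> graded P d (fop \<phi> (comm Z) X)"
  unfolding fop_def by (intro graded_Ssum graded_arith graded_comm_funpow)

lemma graded_eps:
  assumes "graded P d X"
  shows "eps X = (if odd d then - X else X)"
proof (rule ser_eqI)
  fix w show "cf (eps X) w = cf (if odd d then - X else X) w"
    using assms by (cases "cf X w = 0") (auto simp: graded_def wsign_conv_wdeg)
qed

lemma graded_UNIV: "graded P d X \<Longrightarrow> graded UNIV d X"
  by (simp add: graded_def)

lemma graded_0_Nil: "graded P d X \<Longrightarrow> d \<noteq> 0 \<Longrightarrow> cf X [] = 0"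
  by (auto simp: graded_def wdeg_def)

definition sbrk :: "ser \<Rightarrow> ser \<Rightarrow> ser" where "sbrk X Y = Ser (brk (cf X) (cf Y))"

text \<open>The Koszul sign is \<open>(1 + s + t - s t) / 2\<close> where \<open>s\<close> and \<open>t\<close> are the signs of the two factors.\<close>
lemma sbrk_eq: "sbrk X Y = X * Y - (1/2) \<bullet> (Y * X + eps Y * X + Y * eps X - eps Y * eps X)"
proof (rule ser_eqI)
  fix w
  show "cf (sbrk X Y) w = cf (X * Y - (1/2) \<bullet> (Y * X + eps Y * X + Y * eps X - eps Y * eps X)) w"
    unfolding sbrk_def brk_def cf_mult cf_scl cf_arith sum_distrib_left cf_Ser
      sum.distrib[symmetric] sum_subtractf[symmetric]
    by (intro sum.cong) (auto simp: wsign_conv_wdeg)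
qed

lemma sbrk_even: "eps X = X \<Longrightarrow> sbrk X Y = comm X Y"
  by (rule ser_eqI) (simp add: sbrk_eq comm_def)

lemma sbrk_odd: "eps X = - X \<Longrightarrow> eps Y = - Y \<Longrightarrow> sbrk X Y = X * Y + Y * X"
  by (rule ser_eqI) (simp add: sbrk_eq)

lemma graded_sbrk:
  assumes "graded P c X" "graded P d Y"
  shows "graded P (c + d) (sbrk X Y)"
proof -
  have "graded P (c + d) (B * A)" if "graded P c A" "graded P d B" for A B
    using graded_mult[OF that(2,1)] by (simp add: add.commute)
  then show ?thesis
    unfolding sbrk_eq using assms graded_mult[of P c X d Y] by (auto intro!: graded_arith(2-5) simp: graded_arith)
qed

lemma ring_hom_sbrk:
  assumes "local_linear S" "\<And>X Y. S (X * Y) = S X * S Y" "\<And>X. S (eps X) = eps (S X)"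
  shows "S (sbrk X Y) = sbrk (S X) (S Y)"
  by (simp add: sbrk_eq local_linearD[OF assms(1)] assms(2,3))

lemma odd_derivation_sbrk:
  assumes D: "local_linear D" and mult: "\<And>X Y. D (X * Y) = D X * Y + eps X * D Y"
    and anti: "\<And>X. D (eps X) = - eps (D X)"
  shows "D (sbrk X Y) = sbrk (D X) Y + sbrk (eps X) (D Y)"
  by (rule ser_eqI) (simp add: sbrk_eq local_linearD[OF D] mult anti algebra_simps)

subsection \<open>Odd derivations\<close>

definition sder :: "(gen \<Rightarrow> ser) \<Rightarrow> ser \<Rightarrow> ser" where
  "sder \<delta> X = Ser (der (\<lambda>x. cf (\<delta> x)) (cf X))"

lemma gens_UNIV: "gens = UNIV"
proof -
  have "x \<in> gens" for x by (cases x) (simp_all add: gens_def)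
  then show ?thesis by blast
qed

lemma cf_sder: "cf (sder \<delta> X) w = (\<Sum>i<length w. \<Sum>j\<in>{i<..length w}. \<Sum>x\<in>UNIV.
      wsign (take i w) * cf X (take i w @ [x] @ drop j w) * cf (\<delta> x) (take (j - i) (drop i w)))"
  by (simp add: sder_def der_def gens_UNIV)

lemma sder_Nil [simp]: "cf (sder \<delta> X) [] = 0"
  by (simp add: cf_sder)

text \<open>The substituted block either starts at the first letter, giving the products with
  \<open>hd_der\<close>, or later, and then the first letter is passed over and contributes its
  sign.\<close>

lemma sder_Cons:
  assumes "\<And>x. cf (\<delta> x) [] = 0"
  shows "cf (sder \<delta> X) (y # w)
    = (\<Sum>x\<in>UNIV. cf (\<delta> x * hd_der x X) (y # w)) + wsign [y] * cf (sder \<delta> (hd_der y X)) w"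
proof -
  let ?f = "\<lambda>i j. \<Sum>x\<in>UNIV. wsign (take i (y # w)) * cf X (take i (y # w) @ [x] @ drop j (y # w))
    * cf (\<delta> x) (take (j - i) (drop i (y # w)))"
  have 1: "cf (sder \<delta> X) (y # w) = (\<Sum>j\<in>{0<..Suc (length w)}. ?f 0 j)
      + (\<Sum>i<length w. \<Sum>j\<in>{Suc i<..Suc (length w)}. ?f (Suc i) j)"
    unfolding cf_sder length_Cons sum.lessThan_Suc_shift ..
  \<comment> \<open>Adding j = 0 evaluates \<delta> x at the empty word, where it is zero.\<close>
  have 2: "(\<Sum>j\<in>{0<..Suc (length w)}. ?f 0 j) = (\<Sum>j\<le>Suc (length w). ?f 0 j)"
    by (intro sum.mono_neutral_left) (auto simp: assms)
  have 3: "(\<Sum>j\<le>Suc (length w). ?f 0 j) = (\<Sum>x\<in>UNIV. cf (\<delta> x * hd_der x X) (y # w))"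
    by (subst sum.swap) (simp add: cf_mult mult.commute del: sum.atMost_Suc)
  have 4: "(\<Sum>j\<in>{Suc i<..Suc (length w)}. ?f (Suc i) j) = (\<Sum>j\<in>{i<..length w}. ?f (Suc i) (Suc j))" for i
    by (rule sum.reindex_bij_witness[of _ Suc "\<lambda>j. j - 1"]) auto
  have "wsign (y # take i w) = wsign [y] * (wsign (take i w) :: rat)" for i
    using wsign_append[of "[y]" "take i w"] by simp
  then have 5: "(\<Sum>i<length w. \<Sum>j\<in>{i<..length w}. ?f (Suc i) (Suc j))
      = wsign [y] * cf (sder \<delta> (hd_der y X)) w"
    by (simp add: cf_sder sum_distrib_left mult.assoc)
  show ?thesis unfolding 1 2 3 4 5 ..
qed

lemma local_linear_sder: "local_linear (sder \<delta>)"
proof (rule local_linearI)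
  show "sder \<delta> (X + Y) = sder \<delta> X + sder \<delta> Y" for X Y
    by (rule ser_eqI) (simp add: cf_sder algebra_simps sum.distrib)
  show "sder \<delta> (c \<bullet> X) = c \<bullet> sder \<delta> X" for c X
    by (rule ser_eqI) (simp add: cf_sder sum_distrib_left mult_ac)
  show "vanish n (sder \<delta> X)" if "vanish n X" for n X
    unfolding vanish_def cf_sder
    by (intro allI impI sum.neutral ballI) (use that in \<open>auto simp: vanish_def\<close>)
qed

lemmas sder_linear = local_linearD(1,2,4-7)[OF local_linear_sder]

lemma hd_der_mult: "hd_der y (X * Y) = hd_der y X * Y + cf X [] \<bullet> hd_der y Y"
  by (rule ser_eqI) (simp add: cf_mult_Cons)

lemma hd_der_eps: "hd_der y (eps X) = wsign [y] \<bullet> eps (hd_der y X)"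
proof (rule ser_eqI)
  fix w show "cf (hd_der y (eps X)) w = cf (wsign [y] \<bullet> eps (hd_der y X)) w"
    using wsign_append[of "[y]" w, where 'a = rat] by simp
qed

lemma sder_1 [simp]: "sder \<delta> 1 = 0"
  by (rule ser_eqI) (simp add: cf_sder cf_1)

lemma sder_mult:
  assumes \<delta>: "\<And>x. cf (\<delta> x) [] = 0"
  shows "sder \<delta> (X * Y) = sder \<delta> X * Y + eps X * sder \<delta> Y"
proof (rule ser_eqI)
  fix w
  show "cf (sder \<delta> (X * Y)) w = cf (sder \<delta> X * Y + eps X * sder \<delta> Y) w"
  proof (induction w arbitrary: X Y)
    case (Cons y w)
    have hd: "hd_der y (sder \<delta> X) = (\<Sum>x\<in>UNIV. hd_der y (\<delta> x * hd_der x X)) + wsign [y] \<bullet> sder \<delta> (hd_der y X)"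
      for X by (rule ser_eqI) (simp add: sder_Cons \<delta>)
    have "cf (sder \<delta> X * Y) (y # w) = (\<Sum>x\<in>UNIV. cf (\<delta> x * hd_der x X * Y) (y # w))
        + wsign [y] * cf (sder \<delta> (hd_der y X) * Y) w"
      by (simp add: cf_mult_Cons[of _ Y] hd distrib_right sum_distrib_right \<delta>)
    moreover have "cf (eps X * sder \<delta> Y) (y # w)
        = wsign [y] * cf (eps (hd_der y X) * sder \<delta> Y) w + cf X [] * cf (sder \<delta> Y) (y # w)"
      by (simp add: cf_mult_Cons hd_der_eps)
    moreover have "cf (sder \<delta> (X * Y)) (y # w)
       = (\<Sum>x\<in>UNIV. cf (\<delta> x * hd_der x X * Y) (y # w)) + wsign [y] * cf (sder \<delta> (hd_der y X) * Y) w
        + (wsign [y] * cf (eps (hd_der y X) * sder \<delta> Y) w + cf X [] * cf (sder \<delta> Y) (y # w))"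
      unfolding sder_Cons[of \<delta> _ y, OF \<delta>] hd_der_mult sder_linear
      by (simp add: Cons.IH distrib_left sum.distrib sum_distrib_left mult.assoc)
    ultimately show ?case by simp
  qed simp
qed

lemma sder_lgen:
  assumes \<delta>: "\<And>x. cf (\<delta> x) [] = 0"
  shows "sder \<delta> (lgen x) = \<delta> x"
proof (rule ser_eqI)
  fix w show "cf (sder \<delta> (lgen x)) w = cf (\<delta> x) w"
  proof (cases w)
    case (Cons y v)
    have "cf (sder \<delta> (lgen x)) w = (\<Sum>z\<in>UNIV. if x = z then cf (\<delta> z) w else 0)"
      unfolding Cons sder_Cons[OF \<delta>]
      by (auto simp: hd_der_lgen sder_linear intro!: sum.cong)
    then show ?thesis using finite_gen_UNIV by simp
  qed (simp add: \<delta>)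
qed

lemma graded_sder:
  assumes \<delta>: "\<And>x. x \<in> P \<Longrightarrow> graded P (gdeg x - 1) (\<delta> x)" and X: "graded P d X"
  shows "graded P (d - 1) (sder \<delta> X)"
  unfolding graded_def
proof (intro allI impI)
  fix w assume "cf (sder \<delta> X) w \<noteq> 0"
  then obtain i where "(\<Sum>j\<in>{i<..length w}. \<Sum>x\<in>UNIV. wsign (take i w)
      * cf X (take i w @ [x] @ drop j w) * cf (\<delta> x) (take (j - i) (drop i w))) \<noteq> 0"
    unfolding cf_sder by (rule sum.not_neutral_contains_not_neutral)
  then obtain j where ij: "j \<in> {i<..length w}" and "(\<Sum>x\<in>UNIV. wsign (take i w)
      * cf X (take i w @ [x] @ drop j w) * cf (\<delta> x) (take (j - i) (drop i w))) \<noteq> 0"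
    by (rule sum.not_neutral_contains_not_neutral)
  from this(2) obtain x where
    *: "wsign (take i w) * cf X (take i w @ [x] @ drop j w) * cf (\<delta> x) (take (j - i) (drop i w)) \<noteq> 0"
    by (rule sum.not_neutral_contains_not_neutral)
  then have 1: "wdeg (take i w @ [x] @ drop j w) = d" "set (take i w @ [x] @ drop j w) \<subseteq> P"
    using X mult_not_zero[OF mult_not_zero[OF *, THEN conjunct1]] unfolding graded_def by blast+
  then have 2: "wdeg (take (j - i) (drop i w)) = gdeg x - 1" "set (take (j - i) (drop i w)) \<subseteq> P"
    using \<delta>[of x] * unfolding graded_def by auto
  have w: "w = take i w @ take (j - i) (drop i w) @ drop j w"
    using ij append_take_drop_id[of "j - i" "drop i w"] by simp
  have "wdeg w = wdeg (take i w) + wdeg (take (j - i) (drop i w)) + wdeg (drop j w)"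
    by (subst w) simp
  then have "wdeg w = d - 1" using 1(1) 2(1) by (simp add: wdeg_def)
  moreover have "set w \<subseteq> P" using 1(2) 2(2) by (subst w) auto
  ultimately show "wdeg w = d - 1 \<and> set w \<subseteq> P" by simp
qed

definition degree_lowering :: "(gen \<Rightarrow> ser) \<Rightarrow> bool" where
  "degree_lowering \<delta> \<longleftrightarrow> (\<forall>x. cf (\<delta> x) [] = 0 \<and> graded UNIV (gdeg x - 1) (\<delta> x))"

text \<open>On generators the degree drops by one, so the parity changes; the defect is a twisted
  derivation and vanishes everywhere.\<close>

lemma sder_eps:
  assumes "degree_lowering \<delta>"
  shows "sder \<delta> (eps X) = - eps (sder \<delta> X)"
proof -
  have \<delta>: "\<And>x. cf (\<delta> x) [] = 0" using assms by (simp add: degree_lowering_def)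
  have "sder \<delta> (eps X) + eps (sder \<delta> X) = 0"
  proof (rule skew_derivation_eq_0[where T = "\<lambda>X. sder \<delta> (eps X) + eps (sder \<delta> X)"])
    show "local_linear (\<lambda>X. sder \<delta> (eps X) + eps (sder \<delta> X))"
      by (rule local_linear_add[OF local_linear_comp[OF local_linear_sder local_linear_eps]
            local_linear_comp[OF local_linear_eps local_linear_sder]])
    show "sder \<delta> (eps (lgen x)) + eps (sder \<delta> (lgen x)) = 0" for x
      using graded_eps[of UNIV "gdeg x - 1" "\<delta> x"] assms
      by (simp add: eps_lgen sder_linear sder_lgen[OF \<delta>] degree_lowering_def wsign_conv_wdeg)
         (simp add: wdeg_def)
    show "sder \<delta> (eps (X * Y)) + eps (sder \<delta> (X * Y)) = (sder \<delta> (eps X) + eps (sder \<delta> X)) * eps Y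
      + X * (sder \<delta> (eps Y) + eps (sder \<delta> Y))" for X Y
      by (simp add: sder_mult[OF \<delta>] algebra_simps)
  qed simp
  then show ?thesis by (simp add: eq_neg_iff_add_eq_0)
qed

section \<open>The Euler derivation\<close>

definition eul :: "ser \<Rightarrow> ser" where "eul X = Ser (\<lambda>w. of_nat (length w) * cf X w)"

lemma cf_eul [simp]: "cf (eul X) w = of_nat (length w) * cf X w"
  by (simp add: eul_def)

lemma local_linear_eul: "local_linear eul"
  by (rule local_linearI) (auto intro!: ser_eqI simp: algebra_simps vanish_def)

lemma eul_1 [simp]: "eul 1 = 0"
  by (rule ser_eqI) (simp add: cf_1)

lemma eul_mult: "eul (X * Y) = eul X * Y + X * eul Y"
proof (rule ser_eqI)
  fix w
  show "cf (eul (X * Y)) w = cf (eul X * Y + X * eul Y) w"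
    unfolding cf_arith cf_eul cf_mult sum_distrib_left sum.distrib[symmetric]
    by (intro sum.cong) (auto simp: algebra_simps of_nat_diff)
qed

subsection \<open>Lie series\<close>

definition lp :: "nat \<Rightarrow> ser \<Rightarrow> ser" where "lp n X = Ser (len_part n (cf X))"
definition LiePoly :: "ser \<Rightarrow> bool" where "LiePoly X \<longleftrightarrow> cf X \<in> lie_poly"
definition Lie :: "ser \<Rightarrow> bool" where "Lie X \<longleftrightarrow> (\<forall>n. LiePoly (lp n X))"

lemma Lie_iff: "Lie X \<longleftrightarrow> lie_series (cf X)"
  by (simp add: Lie_def LiePoly_def lie_series_def lp_def)

lemma cf_lp: "cf (lp n X) w = (if length w = n then cf X w else 0)"
  by (simp add: lp_def len_part_def)

lemma local_linear_lp: "local_linear (lp n)"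
  by (rule local_linearI) (auto intro!: ser_eqI simp: cf_lp vanish_def)

lemmas lp_linear = local_linearD(1,2,4-7)[OF local_linear_lp]

lemma lp_eps: "lp n (eps X) = eps (lp n X)"
  by (rule ser_eqI) (simp add: cf_lp)

lemma cf_lp_mult_lp:
  "cf (lp i X * lp j Y) w = (if length w = i + j then cf X (take i w) * cf Y (drop i w) else 0)"
proof -
  have "cf (lp i X * lp j Y) w
    = (\<Sum>k\<le>length w. if k = i then (if length w = i + j then cf X (take i w) * cf Y (drop i w) else 0) else 0)"
    unfolding cf_mult by (intro sum.cong) (auto simp: cf_lp)
  then show ?thesis by simp
qed

lemma lp_mult: "lp n (X * Y) = (\<Sum>i\<le>n. lp i X * lp (n - i) Y)"
  by (rule ser_eqI) (auto simp: cf_lp cf_lp_mult_lp cf_mult[of X Y])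

lemma lp_mult': "lp n (X * Y) = (\<Sum>i\<le>n. lp (n - i) X * lp i Y)"
  unfolding lp_mult by (rule sum.reindex_bij_witness[of _ "\<lambda>i. n - i" "\<lambda>i. n - i"]) auto

text \<open>The reversed products are expanded by \<open>lp_mult'\<close>, so that the index i
  always belongs to X and the summands reassemble into brackets.\<close>

lemma lp_sbrk: "lp n (sbrk X Y) = (\<Sum>i\<le>n. sbrk (lp i X) (lp (n - i) Y))"
  unfolding sbrk_eq lp_linear lp_mult[of n X Y] lp_mult'[of n Y] lp_mult'[of n "eps Y"] lp_eps
  by (simp only: sum.distrib sum_subtractf scl_sum scl_distribs)

lemma LiePoly_lgen: "LiePoly (lgen x)"
  by (simp add: LiePoly_def lgen_def lie_poly.gen)

lemma LiePoly_add: "LiePoly X \<Longrightarrow> LiePoly Y \<Longrightarrow> LiePoly (X + Y)"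
  using lie_poly.add[of "cf X" "cf Y"] by (simp add: LiePoly_def plus_ser.rep_eq)

lemma LiePoly_scl: "LiePoly X \<Longrightarrow> LiePoly (c \<bullet> X)"
  using lie_poly.smul[of "cf X" c] by (simp add: LiePoly_def scl_def smul_s_def)

lemma LiePoly_sbrk: "LiePoly X \<Longrightarrow> LiePoly Y \<Longrightarrow> LiePoly (sbrk X Y)"
  using lie_poly.brk[of "cf X" "cf Y"] by (simp add: LiePoly_def sbrk_def)

lemma LiePoly_0: "LiePoly 0"
  using LiePoly_scl[OF LiePoly_lgen, of 0] by simp

lemma LiePoly_sum: "(\<And>i. i \<in> A \<Longrightarrow> LiePoly (F i)) \<Longrightarrow> LiePoly (sum F A)"
  by (induction A rule: infinite_finite_induct) (auto simp: LiePoly_0 LiePoly_add)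

lemma LiePoly_induct [consumes 1, case_names gen add scl sbrk]:
  assumes "LiePoly X" and "\<And>x. Q (lgen x)" and "\<And>X Y. Q X \<Longrightarrow> Q Y \<Longrightarrow> Q (X + Y)"
    and "\<And>c X. Q X \<Longrightarrow> Q (c \<bullet> X)" and "\<And>X Y. Q X \<Longrightarrow> Q Y \<Longrightarrow> Q (sbrk X Y)"
  shows "Q X"
proof -
  have "Q (Ser Y)" if "Y \<in> lie_poly" for Y
    using that
  proof induction
    case (gen x)
    show ?case using assms(2)[of x] by (simp add: lgen_def)
  next
    case (add X Y)
    then show ?case using assms(3)[of "Ser X" "Ser Y"] by (simp add: plus_ser.abs_eq)
  next
    case (smul X c)
    then show ?case using assms(4)[of "Ser X" c] by (simp add: scl_def smul_s_def)
  next
    case (brk X Y)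
    then show ?case using assms(5)[of "Ser X" "Ser Y"] by (simp add: sbrk_def)
  qed
  then show ?thesis using assms(1) by (metis LiePoly_def Ser_cf)
qed

lemma Lie_add: "Lie X \<Longrightarrow> Lie Y \<Longrightarrow> Lie (X + Y)"
  by (simp add: Lie_def lp_linear LiePoly_add)

lemma Lie_scl: "Lie X \<Longrightarrow> Lie (c \<bullet> X)"
  by (simp add: Lie_def lp_linear LiePoly_scl)

lemma Lie_uminus: "Lie X \<Longrightarrow> Lie (- X)"
  using Lie_scl[of X "- 1"] by simp

lemma Lie_diff: "Lie X \<Longrightarrow> Lie Y \<Longrightarrow> Lie (X - Y)"
  using Lie_add[of X "- Y"] Lie_uminus by simp

lemma Lie_0: "Lie 0"
  by (simp add: Lie_def lp_linear LiePoly_0)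

lemma Lie_sbrk: "Lie X \<Longrightarrow> Lie Y \<Longrightarrow> Lie (sbrk X Y)"
  by (simp add: Lie_def lp_sbrk LiePoly_sum LiePoly_sbrk)

lemma Lie_lgen: "Lie (lgen x)"
proof -
  have "lp n (lgen x) = (if n = 1 then lgen x else 0)" for n
    by (rule ser_eqI) (auto simp: cf_lp cf_lgen)
  then show ?thesis by (simp add: Lie_def LiePoly_lgen LiePoly_0)
qed

lemma LiePoly_imp_Lie: "LiePoly X \<Longrightarrow> Lie X"
  by (induction rule: LiePoly_induct) (simp_all add: Lie_lgen Lie_add Lie_scl Lie_sbrk)

lemma Lie_Nil:
  assumes "Lie X"
  shows "cf X [] = 0"
proof -
  have "cf Y [] = 0" if "LiePoly Y" for Y
    using that by (induction rule: LiePoly_induct) (simp_all add: cf_lgen sbrk_eq)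
  from this[of "lp 0 X"] show ?thesis using assms by (simp add: Lie_def cf_lp)
qed

lemma Lie_Ssum:
  assumes "\<And>n. Lie (F n)" "locfin F"
  shows "Lie (Ssum F)"
proof -
  have "lp m (Ssum F) = (\<Sum>n\<le>m. lp m (F n))" for m
    by (rule ser_eqI) (auto simp: cf_lp cf_Ssum)
  then show ?thesis using assms by (simp add: Lie_def LiePoly_sum)
qed

text \<open>T may mix lengths, yet the part of T X of length n comes from the parts of X of length
  at most n, a finite sum.\<close>

lemma Lie_local_linear:
  assumes T: "local_linear T" and L: "\<And>X. LiePoly X \<Longrightarrow> Lie (T X)" and X: "Lie X"
  shows "Lie (T X)"
proof -
  have "lp n (T X) = (\<Sum>i\<le>n. lp n (T (lp i X)))" for n
  proof (rule ser_eqI)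
    fix w
    have "cf (T X) w = cf (T (\<Sum>i\<le>n. lp i X)) w" if "length w = n"
      by (rule local_linear_cong[OF T]) (use that in \<open>simp add: cf_lp\<close>)
    then show "cf (lp n (T X)) w = cf (\<Sum>i\<le>n. lp n (T (lp i X))) w"
      by (simp add: cf_lp local_linearD[OF T])
  qed
  then show ?thesis using L X by (simp add: Lie_def LiePoly_sum)
qed

lemma Lie_ring_hom:
  assumes S: "local_linear S" "\<And>X Y. S (X * Y) = S X * S Y" "\<And>X. S (eps X) = eps (S X)"
    and gen: "\<And>x. Lie (S (lgen x))" and X: "Lie X"
  shows "Lie (S X)"
proof (rule Lie_local_linear[OF S(1) _ X])
  fix X assume "LiePoly X"
  then show "Lie (S X)"
    by (induction rule: LiePoly_induct)
       (simp_all add: gen local_linearD[OF S(1)] Lie_add Lie_scl ring_hom_sbrk[OF S] Lie_sbrk)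
qed

lemma Lie_eps: "Lie X \<Longrightarrow> Lie (eps X)"
  by (rule Lie_ring_hom[OF local_linear_eps]) (simp_all add: eps_lgen Lie_scl Lie_lgen)

lemma Lie_sder:
  assumes \<delta>: "degree_lowering \<delta>" "\<And>x. Lie (\<delta> x)" and X: "Lie X"
  shows "Lie (sder \<delta> X)"
proof (rule Lie_local_linear[OF local_linear_sder _ X])
  have 0: "\<And>x. cf (\<delta> x) [] = 0" using \<delta>(1) by (simp add: degree_lowering_def)
  fix X assume "LiePoly X"
  \<comment> \<open>The derivative of a bracket contains the arguments themselves, so both
    properties are carried along.\<close>
  then have "Lie X \<and> Lie (sder \<delta> X)"
    by (induction rule: LiePoly_induct)
       (simp_all add: sder_lgen[OF 0] \<delta>(2) sder_linear Lie_add Lie_scl Lie_sbrk Lie_lgen Lie_eps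
         odd_derivation_sbrk[OF local_linear_sder sder_mult[OF 0] sder_eps[OF \<delta>(1)]])
  then show "Lie (sder \<delta> X)" ..
qed

lemma Lie_eul: "Lie X \<Longrightarrow> Lie (eul X)"
proof -
  have "lp n (eul X) = of_nat n \<bullet> lp n X" for n
    by (rule ser_eqI) (simp add: cf_lp)
  then show "Lie X \<Longrightarrow> Lie (eul X)" by (simp add: Lie_def LiePoly_scl)
qed

lemma Lie_fop_comm:
  assumes "Lie Z" "eps Z = Z" "Lie X"
  shows "Lie (fop \<phi> (comm Z) X)"
proof -
  have "Lie ((comm Z ^^ n) X)" for n
    by (induction n) (simp_all add: assms Lie_sbrk sbrk_even[OF assms(2), symmetric])
  then show ?thesis
    unfolding fop_def
    by (intro Lie_Ssum Lie_scl contracting_locfin contracting_comm Lie_Nil assms(1))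
qed

subsection \<open>Exponentials of Lie series\<close>

text \<open>With \<open>E\<close> the derivation that multiplies a word by its length, \<open>psi (ad Z) (E Z) = R\<close>
  gives \<open>E Z = phi2 (ad Z) R\<close>, which determines the part of \<open>Z\<close> of length \<open>n\<close> from the
  shorter ones.\<close>
lemma Lie_of_eul:
  assumes Z: "cf Z [] = 0" "eps Z = Z" and R: "Lie R" and eq: "fop psi (comm Z) (eul Z) = R"
  shows "Lie Z"
proof -
  have eul: "eul Z = fop phi2 (comm Z) R"
    using fop_mult[OF contracting_comm[OF Z(1)], of phi2 psi "eul Z"] eq psi_phi2
    by (simp add: mult.commute fop_1)
  have "LiePoly (lp n Z)" for n
  proof (induction n rule: less_induct)
    case (less n)
    define T where "T = (\<Sum>k<n. lp k Z)"
    have cfT: "cf T w = (if length w < n then cf Z w else 0)" for w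
      by (simp add: T_def cf_lp)
    have T0: "cf T [] = 0" by (simp add: cfT Z)
    have ZT: "vanish n (Z - T)" by (simp add: vanish_def cfT)
    have "Lie T" unfolding T_def by (intro LiePoly_imp_Lie LiePoly_sum less) simp
    moreover have "eps T = T" by (simp add: T_def lp_eps[symmetric] Z)
    ultimately have L: "Lie (fop phi2 (comm T) R)" by (rule Lie_fop_comm[OF _ _ R])
    \<comment> \<open>No iterated commutator here has a constant term, so its product with Z - T,
      which starts at length n, is invisible in length n.\<close>
    have B: "vanish (Suc 0) ((comm T ^^ m) R)" for m
      by (rule vanish_mono[OF contracting_funpow[OF contracting_comm[OF T0], of "Suc 0" R m]])
         (simp_all add: vanish_1 Lie_Nil[OF R])
    have A: "vanish (Suc n) ((comm Z ^^ m) R - (comm T ^^ m) R)" for m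
    proof (induction m)
      case (Suc m)
      let ?A = "(comm Z ^^ m) R" and ?B = "(comm T ^^ m) R"
      have "comm Z ?A - comm T ?B = (Z * (?A - ?B) - (?A - ?B) * Z) + ((Z - T) * ?B - ?B * (Z - T))"
        by (simp add: comm_def algebra_simps)
      moreover have "vanish (Suc n) (Z * (?A - ?B))" "vanish (Suc n) ((?A - ?B) * Z)"
        using vanish_mult[OF vanish_0 Suc] vanish_mult[OF Suc vanish_0] by simp_all
      moreover have "vanish (Suc n) ((Z - T) * ?B)" "vanish (Suc n) (?B * (Z - T))"
        using vanish_mult[OF ZT B] vanish_mult[OF B ZT] by simp_all
      ultimately show ?case by (simp add: vanish_arith)
    qed (simp add: vanish_arith)
    have "cf ((comm Z ^^ m) R) w = cf ((comm T ^^ m) R) w" if "length w = n" for w m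
      using A[of m] that by (simp add: vanish_def)
    then have "lp n (eul Z) = lp n (fop phi2 (comm T) R)"
      unfolding eul by (intro ser_eqI) (simp add: cf_lp fop_def cf_Ssum)
    then have "LiePoly (lp n (eul Z))" using L by (simp add: Lie_def)
    then have "LiePoly ((1 / of_nat n) \<bullet> lp n (eul Z))" by (rule LiePoly_scl)
    \<comment> \<open>For n = 0 the division by zero is harmless, the constant term of Z being
      zero.\<close>
    moreover have "lp n Z = (1 / of_nat n) \<bullet> lp n (eul Z)"
      by (rule ser_eqI) (auto simp: cf_lp Z)
    ultimately show ?case by simp
  qed
  then show ?thesis by (simp add: Lie_def)
qed

text \<open>A substitute for being the exponential of an even Lie series, chosen to be closed under
  products: the logarithmic derivative G^(-1) E(G) is Lie, and conjugation by G preserves Lie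
  series. Both are written as right factors of G to avoid inverses.\<close>

definition LieGroup :: "ser \<Rightarrow> bool" where
  "LieGroup G \<longleftrightarrow> cf G [] = 1 \<and> eps G = G \<and> (\<exists>R. Lie R \<and> eul G = G * R)
     \<and> (\<forall>X. Lie X \<longrightarrow> (\<exists>Y. Lie Y \<and> X * G = G * Y))"

lemma LieGroup_1: "LieGroup 1"
  unfolding LieGroup_def by (simp add: cf_1) (use Lie_0 in blast)

text \<open>The logarithmic derivative of G H is H^(-1) R H + S, which is where the conjugation
  clause enters.\<close>

lemma LieGroup_mult:
  assumes G: "LieGroup G" and H: "LieGroup H"
  shows "LieGroup (G * H)"
proof -
  have conj: "\<exists>Y. Lie Y \<and> X * K = K * Y" if "LieGroup K" "Lie X" for K X
    using that unfolding LieGroup_def by blast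
  obtain R where R: "Lie R" "eul G = G * R" using G unfolding LieGroup_def by blast
  obtain S where S: "Lie S" "eul H = H * S" using H unfolding LieGroup_def by blast
  obtain R' where R': "Lie R'" "R * H = H * R'" using conj[OF H R(1)] by blast
  have "eul (G * H) = G * (R * H) + G * H * S"
    unfolding eul_mult R S by (simp only: mult.assoc)
  then have "eul (G * H) = G * H * (R' + S)"
    unfolding R' by (simp only: distrib_left mult.assoc)
  then have "\<exists>R. Lie R \<and> eul (G * H) = G * H * R" using Lie_add[OF R'(1) S(1)] by blast
  moreover have "\<exists>Y. Lie Y \<and> X * (G * H) = G * H * Y" if X: "Lie X" for X
  proof -
    obtain Y where Y: "Lie Y" "X * G = G * Y" using conj[OF G X] by blast
    obtain Y' where Y': "Lie Y'" "Y * H = H * Y'" using conj[OF H Y(1)] by blast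
    have "X * (G * H) = X * G * H" by (simp only: mult.assoc)
    also have "\<dots> = G * (Y * H)" unfolding Y by (simp only: mult.assoc)
    also have "\<dots> = G * H * Y'" unfolding Y' by (simp only: mult.assoc)
    finally show ?thesis using Y'(1) by blast
  qed
  moreover have "cf (G * H) [] = 1" "eps (G * H) = G * H" using G H by (simp_all add: LieGroup_def)
  ultimately show ?thesis unfolding LieGroup_def by blast
qed

lemma eps_fev: "eps X = X \<Longrightarrow> cf X [] = 0 \<Longrightarrow> eps (fev \<phi> X) = fev \<phi> X"
  using ring_hom_fev[OF local_linear_eps eps_1 eps_mult, of X \<phi>] by simp

lemma LieGroup_sexp:
  assumes X: "Lie X" "eps X = X"
  shows "LieGroup (sexp X)"
  unfolding LieGroup_def
proof (intro conjI allI impI)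
  show "eps (sexp X) = sexp X" using eps_fev X Lie_Nil by (simp add: sexp_def)
  have "eul (sexp X) = sexp X * fop psi (comm X) (eul X)"
    by (rule derivation_sexp[OF local_linear_eul]) (simp_all add: eul_mult Lie_Nil X)
  then show "\<exists>R. Lie R \<and> eul (sexp X) = sexp X * R"
    using Lie_fop_comm[OF X Lie_eul[OF X(1)]] by blast
  show "\<exists>Y'. Lie Y' \<and> Y * sexp X = sexp X * Y'" if "Lie Y" for Y
    using mult_sexp[OF Lie_Nil[OF X(1)], of Y] Lie_fop_comm[OF X that] by blast
qed simp

text \<open>Cancelling exp(Z), for Z = \<open>slog G\<close>, between the two formulas for
  \<open>eul G\<close> leaves the equation treated in \<open>Lie_of_eul\<close>.\<close>

lemma Lie_slog:
  assumes "LieGroup G"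
  shows "Lie (slog G)" "eps (slog G) = slog G"
proof -
  have G: "cf G [] = 1" "eps G = G" using assms unfolding LieGroup_def by blast+
  obtain R where R: "Lie R" "eul G = G * R" using assms unfolding LieGroup_def by blast+
  show e: "eps (slog G) = slog G"
    unfolding slog_def by (rule eps_fev) (use G in \<open>simp_all add: cf_1\<close>)
  have "eul (sexp (slog G)) = sexp (slog G) * fop psi (comm (slog G)) (eul (slog G))"
    by (rule derivation_sexp[OF local_linear_eul]) (simp_all add: eul_mult)
  then have "sexp (- slog G) * (sexp (slog G) * fop psi (comm (slog G)) (eul (slog G)))
      = sexp (- slog G) * (sexp (slog G) * R)"
    using R sexp_slog[OF G(1)] by simp
  then have "fop psi (comm (slog G)) (eul (slog G)) = R"
    by (simp add: mult.assoc[symmetric] sexp_inverse)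
  then show "Lie (slog G)" by (rule Lie_of_eul[rotated 3]) (simp_all add: e R)
qed

definition expprod :: "ser list \<Rightarrow> ser" where
  "expprod xs = foldr (\<lambda>X P. sexp X * P) xs 1"

definition sBCH :: "ser list \<Rightarrow> ser" where "sBCH xs = slog (expprod xs)"

lemma expprod_simps [simp]: "expprod [] = 1" "expprod (X # xs) = sexp X * expprod xs"
  by (simp_all add: expprod_def)

lemma expprod_Nil [simp]: "cf (expprod xs) [] = 1"
  by (induction xs) (simp_all add: cf_1)

lemma sexp_sBCH: "sexp (sBCH xs) = expprod xs"
  by (simp add: sBCH_def sexp_slog)

lemma sBCH_Nil [simp]: "cf (sBCH xs) [] = 0"
  by (simp add: sBCH_def)

lemma Lie_sBCH:
  assumes "\<And>X. X \<in> set xs \<Longrightarrow> Lie X \<and> eps X = X"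
  shows "Lie (sBCH xs)"
proof -
  have "LieGroup (expprod xs)"
    using assms by (induction xs) (auto simp: LieGroup_1 intro!: LieGroup_mult LieGroup_sexp)
  then show ?thesis by (simp add: sBCH_def Lie_slog)
qed

lemma graded_sBCH:
  assumes "\<And>X. X \<in> set xs \<Longrightarrow> graded P 0 X"
  shows "graded P 0 (sBCH xs)"
proof -
  have "graded P 0 (expprod xs)"
    using assms graded_mult[of P 0 _ 0]
    by (induction xs) (auto simp: graded_1 sexp_def graded_fev)
  then show ?thesis
    unfolding sBCH_def slog_def by (intro graded_fev graded_arith graded_1)
qed

subsection \<open>The gauge flow\<close>

text \<open>Variation of constants for dz/dt = V - ad_W(z) at time 1: exp(-ad_W) Y plus the integral
  over [0, 1] of exp(-s ad_W) V, which is \<open>psi\<close> at ad_W.\<close>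

definition gauge :: "ser \<Rightarrow> ser \<Rightarrow> ser \<Rightarrow> ser" where
  "gauge W V Y = fop (fps_exp (- 1)) (comm W) Y + fop psi (comm W) V"

text \<open>Where the second argument is evaluated at all of w, it is multiplied by the zero
  constant term of X. This makes the flow equation triangular in word length.\<close>

lemma brk_cong_right:
  assumes "X [] = 0" "\<And>v. length v < length w \<Longrightarrow> Y v = Z v"
  shows "brk X Y w = brk X Z w"
  unfolding brk_def
proof (intro sum.cong refl)
  fix i assume i: "i \<in> {..length w}"
  have "X (take i w) * Y (drop i w) = X (take i w) * Z (drop i w)"
    using assms i by (cases "i = 0") auto
  moreover have "Y (take i w) * X (drop i w) = Z (take i w) * X (drop i w)"
    using assms i by (cases "i = length w") auto
  ultimately show "X (take i w) * Y (drop i w)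
      - (if odd (wdeg (take i w)) \<and> odd (wdeg (drop i w)) then -1 else 1) * Y (take i w) * X (drop i w)
    = X (take i w) * Z (drop i w)
      - (if odd (wdeg (take i w)) \<and> odd (wdeg (drop i w)) then -1 else 1) * Z (take i w) * X (drop i w)"
    by simp
qed

lemma brk_of_rat_sum:
  fixes a :: "nat \<Rightarrow> real"
  shows "brk (\<lambda>v. of_rat (X v)) (\<lambda>v. \<Sum>n\<in>A. a n * of_rat (F n v)) w
    = (\<Sum>n\<in>A. a n * of_rat (brk X (F n) w))"
proof -
  have "(\<Sum>n\<in>A. a n * of_rat (brk X (F n) w)) = (\<Sum>i\<le>length w. \<Sum>n\<in>A. a n *
      of_rat (X (take i w) * F n (drop i w) - (if odd (wdeg (take i w)) \<and> odd (wdeg (drop i w)) then -1 else 1)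
        * F n (take i w) * X (drop i w)))"
    unfolding brk_def of_rat_sum sum_distrib_left by (rule sum.swap)
  also have "\<dots> = brk (\<lambda>v. of_rat (X v)) (\<lambda>v. \<Sum>n\<in>A. a n * of_rat (F n v)) w"
    unfolding brk_def sum_distrib_left sum_distrib_right sum_subtractf[symmetric]
    by (intro sum.cong refl) (auto simp: of_rat_mult of_rat_diff of_rat_add algebra_simps)
  finally show ?thesis ..
qed

text \<open>By triangularity and induction on length, the bracket terms of two solutions agree at w,
  so their difference is constant in time.\<close>

lemma gauge_ode_unique:
  fixes y z :: "real \<Rightarrow> real series"
  assumes W: "W [] = 0" and init: "\<And>w. y 0 w = z 0 w"
    and y: "\<And>t w. ((\<lambda>s. y s w) has_real_derivative V w - brk W (y t) w) (at t)"
    and z: "\<And>t w. ((\<lambda>s. z s w) has_real_derivative V w - brk W (z t) w) (at t)"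
  shows "y t w = z t w"
proof (induction "length w" arbitrary: w t rule: less_induct)
  case less
  have "((\<lambda>s. y s w - z s w) has_real_derivative 0) (at t)" for t
  proof -
    have "brk W (y t) w = brk W (z t) w" using less W by (intro brk_cong_right)
    then show ?thesis using DERIV_diff[OF y[of w t] z[of w t]] by simp
  qed
  from DERIV_isconst_all[of "\<lambda>s. y s w - z s w" t 0] this have "y t w - z t w = y 0 w - z 0 w"
    by blast
  then show ?case by (simp add: init)
qed

text \<open>The definite description needs existence, through an explicit solution whose
  coefficients are polynomials in t, as well as uniqueness.\<close>

lemma u_flow_eq_gauge:
  assumes W: "cf W [] = 0" "eps W = W"
  shows "u_flow (cf W) (cf Y) = cf (gauge W (Ser (dA (cf W))) Y)"
proof -
  define V where "V = Ser (dA (cf W))"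
  \<comment> \<open>These are the coefficients of exp(-t ad_W). Their antiderivatives vanishing at 0
    are \<open>- \<alpha> (Suc n)\<close>, which explains the forcing term of
    \<open>z\<close>.\<close>
  define \<alpha> :: "nat \<Rightarrow> real \<Rightarrow> real" where "\<alpha> n t = (- t) ^ n / fact n" for n t
  define c where "c X n w = (of_rat (cf ((comm W ^^ n) X) w) :: real)" for X n w
  define z where "z t w = (\<Sum>n\<le>length w. \<alpha> n t * c Y n w) - (\<Sum>n\<le>length w. \<alpha> (Suc n) t * c V n w)"
    for t w
  have d\<alpha>: "(\<alpha> (Suc n) has_real_derivative - \<alpha> n t) (at t)" for n t
  proof -
    have "((\<lambda>s. (- s) ^ Suc n) has_real_derivative real (Suc n) * (- 1 * (- t) ^ n)) (at t)"
      by (rule derivative_eq_intros refl | simp)+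
    from DERIV_cdivide[OF this, of "fact (Suc n)"] show ?thesis
      unfolding \<alpha>_def fact_Suc of_nat_mult by (simp del: of_nat_Suc power_Suc)
  qed
  have d\<alpha>0: "(\<alpha> 0 has_real_derivative 0) (at t)" for t
    unfolding \<alpha>_def by simp
  have c0: "c X n w = 0" if "length w < n" for X n w
    using contracting_funpow[OF contracting_comm[OF W(1)], of 0 X n] that
    by (simp add: c_def vanish_def)
  have trunc: "(\<Sum>n\<le>length v. a n * c X n v) = (\<Sum>n\<le>N. a n * c X n v)" if "length v \<le> N" for v N X and a :: "nat \<Rightarrow> real"
    by (rule sum.mono_neutral_left) (use that c0 in auto)
  have brk: "brk (\<lambda>v. of_rat (cf W v)) (\<lambda>v. \<Sum>n\<le>N. a n * c X n v) w = (\<Sum>n\<le>N. a n * c X (Suc n) w)"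
    for N X w and a :: "nat \<Rightarrow> real"
  proof -
    have "brk (cf W) (cf ((comm W ^^ n) X)) w = cf ((comm W ^^ Suc n) X) w" for n
      using sbrk_even[OF W(2), of "(comm W ^^ n) X"] by (metis cf_Ser funpow.simps(2) comp_apply sbrk_def)
    then show ?thesis unfolding c_def by (simp only: brk_of_rat_sum)
  qed
  have brk_diff: "brk A (\<lambda>v. f v - g v) w = brk A f w - brk A g w" for A f g :: "real series" and w
    by (simp add: brk_def sum_subtractf[symmetric] algebra_simps)
  have ode: "((\<lambda>s. z s w) has_real_derivative (of_rat (cf V w) - brk (\<lambda>v. of_rat (cf W v)) (z t) w)) (at t)" for t w
  proof -
    let ?N = "length w"
    \<comment> \<open>Enlarging the range by a vanishing term and splitting off n = 0 leaves indices
      to which \<open>d\<alpha>\<close> applies.\<close>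
    have 1: "(\<lambda>s. z s w) = (\<lambda>s. \<alpha> 0 s * c Y 0 w + (\<Sum>n\<le>?N. \<alpha> (Suc n) s * c Y (Suc n) w)
        - (\<alpha> (Suc 0) s * c V 0 w + (\<Sum>n\<le>?N. \<alpha> (Suc (Suc n)) s * c V (Suc n) w)))"
      unfolding z_def using trunc[of w "Suc ?N"]
      by (intro ext) (simp only: sum.atMost_Suc_shift le_SucI order_refl)
    have 2: "((\<lambda>s. z s w) has_real_derivative 0 * c Y 0 w + (\<Sum>n\<le>?N. - \<alpha> n t * c Y (Suc n) w)
        - (- \<alpha> 0 t * c V 0 w + (\<Sum>n\<le>?N. - \<alpha> (Suc n) t * c V (Suc n) w))) (at t)"
      unfolding 1 by (intro DERIV_diff DERIV_add DERIV_sum DERIV_cmult_right d\<alpha> d\<alpha>0)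
    have 3: "brk (\<lambda>v. of_rat (cf W v)) (z t) w
        = (\<Sum>n\<le>?N. \<alpha> n t * c Y (Suc n) w) - (\<Sum>n\<le>?N. \<alpha> (Suc n) t * c V (Suc n) w)"
    proof -
      have "brk (\<lambda>v. of_rat (cf W v)) (z t) w = brk (\<lambda>v. of_rat (cf W v))
          (\<lambda>v. (\<Sum>n\<le>?N. \<alpha> n t * c Y n v) - (\<Sum>n\<le>?N. \<alpha> (Suc n) t * c V n v)) w"
        by (rule brk_cong_right) (simp_all add: W z_def trunc[of _ ?N])
      then show ?thesis by (simp only: brk_diff brk)
    qed
    have 4: "\<alpha> 0 t * c V 0 w = of_rat (cf V w)" by (simp add: \<alpha>_def c_def)
    show ?thesis by (rule DERIV_cong[OF 2]) (simp add: 3 4 sum_negf)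
  qed
  have z0: "z 0 w = of_rat (cf Y w)" for w
  proof -
    have "(\<Sum>n\<le>length w. \<alpha> n 0 * c Y n w) = (\<Sum>n\<le>length w. if n = 0 then of_rat (cf Y w) else 0)"
      by (intro sum.cong) (auto simp: \<alpha>_def c_def)
    then show ?thesis by (simp add: z_def \<alpha>_def)
  qed
  have z1: "z 1 w = of_rat (cf (gauge W V Y) w)" for w
  proof -
    have of_rat_fact: "of_rat (fact n) = (fact n :: real)" for n
      by (metis of_nat_fact of_rat_of_nat_eq)
    have "\<alpha> n 1 = of_rat (fps_nth (fps_exp (- 1)) n)" "- \<alpha> (Suc n) 1 = of_rat (fps_nth psi n)" for n
      by (simp_all add: \<alpha>_def psi_def of_rat_divide of_rat_power of_rat_minus of_rat_fact del: fact_Suc)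
    then have "of_rat (cf (gauge W V Y) w)
       = (\<Sum>n\<le>length w. \<alpha> n 1 * c Y n w) + (\<Sum>n\<le>length w. - \<alpha> (Suc n) 1 * c V n w)"
      by (simp only: gauge_def cf_arith fop_def cf_Ssum cf_scl c_def of_rat_add of_rat_sum of_rat_mult)
    then show ?thesis by (simp add: z_def sum_negf)
  qed
  show ?thesis
    unfolding u_flow_def V_def[symmetric]
  proof (rule the_equality)
    show "\<exists>z :: real \<Rightarrow> real series. (\<forall>w. z 0 w = of_rat (cf Y w)) \<and>
      (\<forall>t w. ((\<lambda>s. z s w) has_real_derivative
        (of_rat (dA (cf W) w) - brk (\<lambda>v. of_rat (cf W v)) (z t) w)) (at t)) \<and>
      (\<forall>w. z 1 w = of_rat (cf (gauge W V Y) w))"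
      using z0 z1 ode by (intro exI[of _ z]) (simp add: V_def)
  next
    fix U
    assume "\<exists>z :: real \<Rightarrow> real series. (\<forall>w. z 0 w = of_rat (cf Y w)) \<and>
      (\<forall>t w. ((\<lambda>s. z s w) has_real_derivative
        (of_rat (dA (cf W) w) - brk (\<lambda>v. of_rat (cf W v)) (z t) w)) (at t)) \<and>
      (\<forall>w. z 1 w = of_rat (U w))"
    then obtain y :: "real \<Rightarrow> real series" where y: "\<And>w. y 0 w = of_rat (cf Y w)"
      "\<And>t w. ((\<lambda>s. y s w) has_real_derivative
        (of_rat (cf V w) - brk (\<lambda>v. of_rat (cf W v)) (y t) w)) (at t)"
      "\<And>w. y 1 w = of_rat (U w)"
      by (auto simp: V_def)
    have "y 1 w = z 1 w" for w
      by (rule gauge_ode_unique[OF _ _ y(2) ode]) (simp_all add: W y z0)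
    then show "U = cf (gauge W V Y)" by (simp add: fun_eq_iff y z1)
  qed
qed

lemma fop_arg_add: "contracting T \<Longrightarrow> fop \<phi> T (X + Y) = fop \<phi> T X + fop \<phi> T Y"
  by (rule ser_eqI)
     (simp add: fop_def cf_Ssum contracting_def local_linearD(1)[OF local_linear_funpow] distrib_left sum.distrib)

section \<open>Translation of the given operations into the ring\<close>

lemma pow_s_cf: "pow_s (cf X) n = cf (X ^ n)"
  by (induction n) (simp_all add: one_ser.rep_eq times_ser.rep_eq)

lemma exp_s_cf: "exp_s (cf X) = cf (sexp X)"
  by (rule ext) (simp add: exp_s_def sexp_def fev_def cf_Ssum pow_s_cf)

lemma log1p_s_cf: "log1p_s (cf X) = cf (fev (fps_ln 1) X)"
proof
  fix w
  have "cf (fev (fps_ln 1) X) w = (\<Sum>n\<in>{1..length w}. fps_nth (fps_ln 1) n * cf (X ^ n) w)"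
    unfolding fev_def cf_Ssum by (intro sum.mono_neutral_cong_right) (auto simp: fps_ln_nth)
  also have "\<dots> = log1p_s (cf X) w"
    unfolding log1p_s_def pow_s_cf
    by (intro sum.cong) (auto simp: fps_ln_nth power_add[symmetric] dest!: Suc_le_D)
  finally show "log1p_s (cf X) w = cf (fev (fps_ln 1) X) w" ..
qed

lemma BCH_cf: "BCH (map cf xs) = cf (sBCH xs)"
proof -
  have "foldr (\<lambda>X P. mult_s (exp_s X) P) (map cf xs) one_s = cf (expprod xs)"
    by (induction xs) (simp_all add: one_ser.rep_eq times_ser.rep_eq exp_s_cf)
  then have "BCH (map cf xs) = log1p_s (cf (expprod xs - 1))"
    unfolding BCH_def by (simp add: minus_ser.rep_eq one_ser.rep_eq)
  then show ?thesis by (simp add: log1p_s_cf sBCH_def slog_def)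
qed

lemma gen_s_cf: "gen_s x = cf (lgen x)"
  by (simp add: lgen_def)

lemma smul_s_cf: "smul_s c (cf X) = cf (c \<bullet> X)"
  by (rule ext) (simp add: smul_s_def)

lemma brk_cf: "brk (cf X) (cf Y) = cf (sbrk X Y)"
  by (simp add: sbrk_def)

lemma fps_ad_cf:
  assumes "eps Y = Y"
  shows "fps_ad \<phi> (cf Y) (cf Z) = cf (fop \<phi> (comm Y) Z)"
proof -
  have "(brk (cf Y) ^^ n) (cf Z) = cf ((comm Y ^^ n) Z)" for n
    by (induction n) (simp_all add: brk_cf sbrk_even[OF assms])
  then show ?thesis by (intro ext) (simp add: fps_ad_def fop_def cf_Ssum)
qed

subsection \<open>The differential of the bi-gon\<close>

abbreviation ga :: ser where "ga \<equiv> lgen Ga"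
abbreviation gb :: ser where "gb \<equiv> lgen Gb"
abbreviation ge :: ser where "ge \<equiv> lgen Ge"
abbreviation gf :: ser where "gf \<equiv> lgen Gf"
abbreviation gg :: ser where "gg \<equiv> lgen Gg"

definition sdeltaA :: "gen \<Rightarrow> ser" where "sdeltaA x = Ser (deltaA x)"
definition sdeltaBar :: "gen \<Rightarrow> ser" where "sdeltaBar x = Ser (deltaBar x)"
abbreviation DA :: "ser \<Rightarrow> ser" where "DA \<equiv> sder sdeltaA"

definition gensA :: "gen set" where "gensA = {Ga, Gb, Ge, Gf}"

lemma lgen_Nil [simp]: "cf (lgen x) [] = 0"
  by (simp add: cf_lgen)

lemma eps_gens [simp]:
  "eps ga = - ga" "eps gb = - gb" "eps ge = ge" "eps gf = gf" "eps gg = - gg"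
  by (simp_all add: eps_lgen wsign_def)

lemma sdeltaA_values:
  "sdeltaA Ga = - (ga * ga)" "sdeltaA Gb = - (gb * gb)"
  "sdeltaA Ge = fop phi1 (comm ge) ga + fop phi2 (comm ge) gb"
  "sdeltaA Gf = fop phi1 (comm gf) gb + fop phi2 (comm gf) ga"
  "sdeltaA Gg = 0"
  by (rule ser_eqI; simp add: sdeltaA_def gen_s_cf brk_cf smul_s_cf fps_ad_cf sbrk_odd algebra_simps)+

lemma sdeltaA_Nil: "cf (sdeltaA x) [] = 0"
  by (cases x) (simp_all add: sdeltaA_values fop_def cf_Ssum)

lemma graded_sdeltaA:
  assumes "x \<in> P" "gensA \<subseteq> P"
  shows "graded P (gdeg x - 1) (sdeltaA x)"
proof -
  have g: "graded P (- 1) ga" "graded P (- 1) gb" "graded P 0 ge" "graded P 0 gf"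
    using assms(2) graded_lgen[of Ga P] graded_lgen[of Gb P] graded_lgen[of Ge P] graded_lgen[of Gf P]
    by (auto simp: gensA_def)
  show ?thesis
    using graded_mult[OF g(1) g(1)] graded_mult[OF g(2) g(2)] g
    by (cases x) (auto simp: sdeltaA_values intro!: graded_arith graded_fop_comm)
qed

lemma Lie_sdeltaA: "Lie (sdeltaA x)"
proof -
  have "sdeltaA Ga = (- 1/2) \<bullet> sbrk ga ga" "sdeltaA Gb = (- 1/2) \<bullet> sbrk gb gb"
    by (simp_all add: sdeltaA_def gen_s_cf brk_cf smul_s_cf)
  then show ?thesis
    by (cases x)
       (simp_all add: sdeltaA_values(3-5) Lie_add Lie_fop_comm Lie_lgen Lie_0 Lie_scl Lie_sbrk Lie_uminus)
qed

lemma degree_lowering_sdeltaA: "degree_lowering sdeltaA"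
  by (simp add: degree_lowering_def sdeltaA_Nil graded_sdeltaA)

section \<open>The loop h at a, the path v, the conjugated loop q and the midpoint x\<close>

definition h_ser :: ser where "h_ser = sBCH [ge, gf]"
definition v_ser :: ser where "v_ser = sBCH [(- 1/2) \<bullet> h_ser, ge]"
definition q_ser :: ser where "q_ser = sBCH [(- 1/2) \<bullet> v_ser, ge, gf, (1/2) \<bullet> v_ser]"
definition x_ser :: ser where "x_ser = gauge ((1/2) \<bullet> v_ser) (DA ((1/2) \<bullet> v_ser)) ga"

lemma graded_gens: "graded gensA (- 1) ga" "graded gensA (- 1) gb" "graded gensA 0 ge" "graded gensA 0 gf"
  using graded_lgen[of Ga gensA] graded_lgen[of Gb gensA] graded_lgen[of Ge gensA] graded_lgen[of Gf gensA]
  by (auto simp: gensA_def)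

lemma graded_h_ser: "graded gensA 0 h_ser"
  unfolding h_ser_def by (rule graded_sBCH) (auto simp: graded_gens)

lemma graded_v_ser: "graded gensA 0 v_ser"
  unfolding v_ser_def by (rule graded_sBCH) (auto simp: graded_gens graded_h_ser intro!: graded_arith)

lemma graded_q_ser: "graded gensA 0 q_ser"
  unfolding q_ser_def by (rule graded_sBCH) (auto simp: graded_gens graded_v_ser intro!: graded_arith)

lemma eps_BCHs [simp]: "eps h_ser = h_ser" "eps v_ser = v_ser" "eps q_ser = q_ser"
  using graded_eps[OF graded_h_ser] graded_eps[OF graded_v_ser] graded_eps[OF graded_q_ser] by simp_all

lemma BCHs_Nil [simp]: "cf h_ser [] = 0" "cf v_ser [] = 0" "cf q_ser [] = 0"
  by (simp_all add: h_ser_def v_ser_def q_ser_def)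

lemma Lie_h_ser: "Lie h_ser"
  unfolding h_ser_def by (rule Lie_sBCH) (auto simp: Lie_lgen)

lemma Lie_v_ser: "Lie v_ser"
  unfolding v_ser_def by (rule Lie_sBCH) (auto simp: Lie_lgen intro!: Lie_uminus Lie_scl Lie_h_ser)

lemma Lie_q_ser: "Lie q_ser"
  unfolding q_ser_def by (rule Lie_sBCH) (auto simp: Lie_lgen intro!: Lie_uminus Lie_scl Lie_v_ser)

lemma graded_x_ser: "graded gensA (- 1) x_ser"
proof -
  have "graded gensA (0 - 1) (DA ((1/2) \<bullet> v_ser))"
    by (rule graded_sder) (auto intro!: graded_sdeltaA graded_arith graded_v_ser)
  then show ?thesis
    unfolding x_ser_def gauge_def
    by (intro graded_arith graded_fop_comm graded_v_ser graded_gens) simp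
qed

lemma eps_x_ser [simp]: "eps x_ser = - x_ser"
  using graded_eps[OF graded_x_ser] by simp

lemma x_ser_Nil [simp]: "cf x_ser [] = 0"
  using graded_0_Nil[OF graded_x_ser] by simp

lemma Lie_x_ser: "Lie x_ser"
  unfolding x_ser_def gauge_def
  by (intro Lie_add Lie_fop_comm Lie_scl Lie_v_ser Lie_lgen Lie_sder degree_lowering_sdeltaA Lie_sdeltaA) simp_all

lemma q_el_eq: "q_el = cf q_ser" and v_el_eq: "v_el = cf v_ser"
proof -
  show v: "v_el = cf v_ser"
    using BCH_cf[of "[ge, gf]"] BCH_cf[of "[(- 1/2) \<bullet> h_ser, ge]"]
    by (simp add: v_el_def gen_s_cf v_ser_def h_ser_def smul_s_cf)
  show "q_el = cf q_ser"
    using BCH_cf[of "[(- 1/2) \<bullet> v_ser, ge, gf, (1/2) \<bullet> v_ser]"]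
    by (simp add: q_el_def v gen_s_cf q_ser_def smul_s_cf)
qed

lemma x_el_eq: "x_el = cf x_ser"
  unfolding x_el_def v_el_eq smul_s_cf gen_s_cf x_ser_def
  by (subst u_flow_eq_gauge) (simp_all add: sder_def dA_def sdeltaA_def)

abbreviation pe :: ser where "pe \<equiv> sexp ge"
abbreviation pe' :: ser where "pe' \<equiv> sexp (- ge)"
abbreviation pf :: ser where "pf \<equiv> sexp gf"
abbreviation pf' :: ser where "pf' \<equiv> sexp (- gf)"
text \<open>The square roots of \<open>(exp e exp f)^(-1)\<close>, \<open>exp e exp f\<close>, \<open>exp v\<close> and \<open>exp (-v)\<close>.\<close>
definition me :: ser where "me = sexp ((- 1/2) \<bullet> h_ser)"
definition me' :: ser where "me' = sexp ((1/2) \<bullet> h_ser)"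
definition sv :: ser where "sv = sexp ((1/2) \<bullet> v_ser)"
definition sv' :: ser where "sv' = sexp ((- 1/2) \<bullet> v_ser)"

lemma inverse_cancel:
  assumes "A * B = (1 :: ser)"
  shows "A * (B * X) = X"
  using assms by (simp add: mult.assoc[symmetric])

lemma inverses [simp]:
  "pe * pe' = 1" "pe' * pe = 1" "pf * pf' = 1" "pf' * pf = 1"
  "me * me' = 1" "me' * me = 1" "sv * sv' = 1" "sv' * sv = 1"
  using sexp_inverse[of ge] sexp_inverse[of gf] sexp_inverse[of "(1/2) \<bullet> h_ser"] sexp_inverse[of "(1/2) \<bullet> v_ser"]
  by (simp_all add: me_def me'_def sv_def sv'_def)

lemmas inverses_cancel [simp] = inverses[THEN inverse_cancel]

lemma sexp_h_ser: "sexp h_ser = pe * pf"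
  unfolding h_ser_def sexp_sBCH by simp

text \<open>\<open>me\<close> is a power of h, so it commutes with h, and h^(-1/2) h = h^(1/2) on
  either side.\<close>

lemma me_holonomy: "me * (pe * pf) = me'" "pe * (pf * me) = me'"
proof -
  show "me * (pe * pf) = me'"
    using sexp_scl_mult[of h_ser "- 1/2" 1] by (simp add: me_def me'_def sexp_h_ser)
  have "sexp h_ser * me = me'"
    using sexp_scl_mult[of h_ser 1 "- 1/2"] by (simp add: me_def me'_def)
  then show "pe * (pf * me) = me'" by (simp add: sexp_h_ser mult.assoc)
qed

lemma sv_sv: "sv * sv = me * pe" and sexp_v_ser: "sexp v_ser = me * pe"
proof -
  show "sexp v_ser = me * pe" unfolding v_ser_def sexp_sBCH by (simp add: me_def)
  then show "sv * sv = me * pe" using sexp_scl_mult[of v_ser "1/2" "1/2"] by (simp add: sv_def)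
qed

lemma sexp_q_ser: "sexp q_ser = sv' * (pe * (pf * sv))"
  unfolding q_ser_def sexp_sBCH by (simp add: sv_def sv'_def)

lemma eps_exps [simp]: "eps pe = pe" "eps pf = pf" "eps me = me" "eps sv = sv" "eps me' = me'" "eps sv' = sv'"
  "eps pe' = pe'" "eps pf' = pf'"
  by (simp_all add: sexp_def me_def sv_def me'_def sv'_def eps_fev)

text \<open>One argument serves for the differential of A^2, with \<open>Gg\<close> sent to 0, and
  for the extended one, since they differ only on \<open>Gg\<close>.\<close>

locale bigon_derivation =
  fixes \<delta> :: "gen \<Rightarrow> ser"
  assumes lowering: "degree_lowering \<delta>"
    and extends: "x \<noteq> Gg \<Longrightarrow> \<delta> x = sdeltaA x"
begin

abbreviation D :: "ser \<Rightarrow> ser" where "D \<equiv> sder \<delta>"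

lemma \<delta>_Nil: "cf (\<delta> x) [] = 0"
  using lowering by (simp add: degree_lowering_def)

lemmas D_mult = sder_mult[OF \<delta>_Nil]
lemmas D_lgen = sder_lgen[OF \<delta>_Nil]
lemmas D_linear [simp] = local_linearD(1,2,4-7)[OF local_linear_sder[of \<delta>]]

lemma D_even: "eps X = X \<Longrightarrow> D (X * Y) = D X * Y + X * D Y"
  by (simp add: D_mult)

lemma D_a: "D ga = - (ga * ga)" and D_b: "D gb = - (gb * gb)"
  by (simp_all add: D_lgen extends sdeltaA_values)

text \<open>Applying \<open>psi\<close> at ad_z turns \<open>phi1\<close> and \<open>phi2\<close>
  into -exp(-ad_z) and 1, so exp(-z) D(exp z) = d - exp(-z) c exp(z): exp(z) is a transport from c
  to d.\<close>

lemma D_edge: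
  assumes "z \<in> {ge, gf}" "D z = fop phi1 (comm z) c + fop phi2 (comm z) d"
  shows "D (sexp z) = sexp z * d - c * sexp z"
proof -
  have z: "cf z [] = 0" "eps z = z" using assms(1) by auto
  note C = contracting_comm[OF z(1)]
  have "fop psi (comm z) (D z) = d - fop (fps_exp (- 1)) (comm z) c"
    by (simp add: assms(2) fop_arg_add[OF C] fop_mult[OF C, symmetric] psi_phi1 psi_phi2 fop_1 fop_uminus)
  moreover have "D (sexp z) = sexp z * fop psi (comm z) (D z)"
    by (rule derivation_sexp[OF local_linear_sder]) (simp_all add: z D_even)
  ultimately show ?thesis by (simp add: right_diff_distrib mult_sexp[OF z(1)])
qed

lemma D_pe: "D pe = pe * gb - ga * pe"
  by (rule D_edge) (simp_all add: D_lgen extends sdeltaA_values)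

lemma D_pf: "D pf = pf * ga - gb * pf"
  by (rule D_edge) (simp_all add: D_lgen extends sdeltaA_values)

text \<open>For odd y the operator sending X to D X + y X - eps(X) y satisfies a twisted Leibniz
  rule, so vanishing at X passes to every power series in X.\<close>

lemma D_stabiliser:
  assumes y: "eps y = - y" and X: "eps X = X" "cf X [] = 0" "D X = X * y - y * X"
  shows "D (fev \<phi> X) = fev \<phi> X * y - y * fev \<phi> X"
proof -
  have "D (fev \<phi> X) + y * fev \<phi> X - eps (fev \<phi> X) * y = 0"
  proof (rule twisted_derivation_fev_eq_0[where D = "\<lambda>X. D X + y * X - eps X * y"])
    show "local_linear (\<lambda>X. D X + y * X - eps X * y)"
      by (rule local_linear_diff[OF local_linear_add[OF local_linear_sder local_linear_mult_left]
            local_linear_comp[OF local_linear_mult_right local_linear_eps]])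
    show "D (X * Y) + y * (X * Y) - eps (X * Y) * y
      = (D X + y * X - eps X * y) * Y + eps X * (D Y + y * Y - eps Y * y)" for Y
      by (simp add: D_mult algebra_simps)
  qed (simp_all add: X)
  then have "D (fev \<phi> X) + y * fev \<phi> X = fev \<phi> X * y"
    unfolding eps_fev[OF X(1,2)] by (simp only: right_minus_eq)
  then show ?thesis by (simp only: eq_diff_eq)
qed

lemma D_stabiliser_slog:
  assumes y: "eps y = - y" and G: "eps G = G" "cf G [] = 1" "D G = G * y - y * G"
  shows "D (slog G) = slog G * y - y * slog G"
  unfolding slog_def by (rule D_stabiliser[OF y]) (simp_all add: G cf_1 algebra_simps)

text \<open>In D(exp(e) exp(f)) the terms with b cancel, as the loop returns to a. The stabiliser
  equation passes to the logarithm and from there to the power -1/2.\<close>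

lemma D_me: "D me = me * ga - ga * me"
proof -
  have "D (pe * pf) = pe * pf * ga - ga * (pe * pf)"
    by (simp add: D_even D_pe D_pf algebra_simps)
  then have "D (slog (pe * pf)) = slog (pe * pf) * ga - ga * slog (pe * pf)"
    by (intro D_stabiliser_slog) simp_all
  then have "D h_ser = h_ser * ga - ga * h_ser"
    by (simp add: h_ser_def sBCH_def)
  then show ?thesis
    unfolding me_def sexp_scl by (intro D_stabiliser) simp_all
qed

lemma D_eq_DA:
  assumes "graded gensA d X"
  shows "D X = DA X"
proof (rule ser_eqI)
  fix w
  have "cf X (u @ [x] @ v) * cf (\<delta> x) t = cf X (u @ [x] @ v) * cf (sdeltaA x) t" for u x v t
  proof (cases "x = Gg")
    case True
    then have "cf X (u @ [x] @ v) = 0" using assms by (auto simp: graded_def gensA_def)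
    then show ?thesis by simp
  qed (simp add: extends)
  then show "cf (D X) w = cf (DA X) w"
    unfolding cf_sder by (simp only: mult.assoc)
qed

text \<open>The inverse-free form of x = s^(-1) a s + s^(-1) D(s), from which the differential of x
  and its symmetries are derived.\<close>

lemma sv_x_ser: "sv * x_ser = ga * sv + D sv"
proof -
  have "D ((1/2) \<bullet> v_ser) = DA ((1/2) \<bullet> v_ser)"
    by (rule D_eq_DA[OF graded_arith(5)[OF graded_v_ser]])
  moreover have "D sv = sv * fop psi (comm ((1/2) \<bullet> v_ser)) (D ((1/2) \<bullet> v_ser))"
    unfolding sv_def by (rule derivation_sexp[OF local_linear_sder]) (simp_all add: D_even scl_distribs)
  moreover have "ga * sv = sv * fop (fps_exp (- 1)) (comm ((1/2) \<bullet> v_ser)) ga"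
    unfolding sv_def by (rule mult_sexp) simp
  ultimately show ?thesis by (simp only: x_ser_def gauge_def distrib_left)
qed

text \<open>The mixed terms \<open>eps (D X) * D Y\<close> and \<open>D (eps X) * D Y\<close>
  cancel, as D anticommutes with parity.\<close>

lemma DD_mult: "D (D (X * Y)) = D (D X) * Y + X * D (D Y)"
  by (simp add: D_mult sder_eps[OF lowering] algebra_simps)

lemma DD_sexp_imp:
  assumes "D (D (sexp z)) = 0" "cf z [] = 0"
  shows "D (D z) = 0"
proof -
  have "D (D (fev (fps_ln 1) (sexp z - 1))) = 0"
    by (rule twisted_derivation_fev_eq_0[where D = "\<lambda>X. D (D X)" and \<alpha> = "\<lambda>X. X" and \<beta> = "\<lambda>X. X"])
       (simp_all add: local_linear_comp[OF local_linear_sder local_linear_sder] DD_mult assms cf_1)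
  then show ?thesis using slog_sexp[OF assms(2)] by (simp add: slog_def)
qed

lemma DD_gens:
  assumes "x \<noteq> Gg"
  shows "D (D (lgen x)) = 0"
proof -
  have "D (D pe) = 0"
    by (simp add: D_pe D_mult D_a D_b algebra_simps)
  moreover have "D (D pf) = 0"
    by (simp add: D_pf D_mult D_a D_b algebra_simps)
  moreover have "D (D ga) = 0" "D (D gb) = 0"
    by (simp_all add: D_a D_b D_mult algebra_simps)
  ultimately show ?thesis using assms DD_sexp_imp[of ge] DD_sexp_imp[of gf] by (cases x) simp_all
qed

lemma DD_eq_0:
  assumes "D (D gg) = 0"
  shows "D (D X) = 0"
proof (rule skew_derivation_eq_0[where T = "\<lambda>X. D (D X)" and \<alpha> = "\<lambda>X. X" and \<beta> = "\<lambda>X. X"])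
  show "D (D (lgen x)) = 0" for x using DD_gens assms by (cases "x = Gg") auto
qed (simp_all add: local_linear_comp[OF local_linear_sder local_linear_sder] DD_mult)

text \<open>The defect D S - S D is a twisted derivation, so generators suffice. The edges are
  tested on exponentials, where D has a closed form, and recovered through the logarithm.\<close>

lemma D_commute:
  assumes S: "local_linear S" "S 1 = 1" "\<And>X Y. S (X * Y) = S X * S Y" "\<And>X. S (eps X) = eps (S X)"
    and comm: "D (S ga) = S (D ga)" "D (S gb) = S (D gb)" "D (S gg) = S (D gg)"
      "D (S pe) = S (D pe)" "D (S pf) = S (D pf)"
  shows "D (S X) = S (D X)"
proof -
  let ?T = "\<lambda>X. D (S X) - S (D X)"
  have T: "local_linear ?T"
    by (rule local_linear_diff[OF local_linear_comp[OF local_linear_sder S(1)] local_linear_comp[OF S(1) local_linear_sder]])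
  have mult: "?T (X * Y) = ?T X * S Y + eps (S X) * ?T Y" for X Y
    by (simp add: S(3,4) D_mult local_linearD[OF S(1)] algebra_simps)
  have edge: "?T z = 0" if z: "?T (sexp z) = 0" "cf z [] = 0" for z
  proof -
    have "?T (fev (fps_ln 1) (sexp z - 1)) = 0"
      by (rule twisted_derivation_fev_eq_0[OF T, where \<alpha> = S and \<beta> = "\<lambda>X. eps (S X)"])
         (use z in \<open>simp_all add: mult cf_1 S(2) local_linearD[OF S(1)]\<close>)
    then show ?thesis using slog_sexp[OF z(2)] by (simp add: slog_def)
  qed
  have "?T X = 0"
  proof (rule skew_derivation_eq_0[OF T, where \<alpha> = S and \<beta> = "\<lambda>X. eps (S X)"])
    show "?T (lgen x) = 0" for x using comm edge[of ge] edge[of gf] by (cases x) simp_all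
  qed (simp_all add: mult S(2) local_linearD[OF S(1)])
  then show ?thesis by simp
qed

end

interpretation A: bigon_derivation sdeltaA
  by unfold_locales (simp_all add: degree_lowering_sdeltaA)

lemma DA_DA: "DA (DA X) = 0"
  by (rule A.DD_eq_0) (simp add: A.D_lgen sdeltaA_values)

lemma graded_DA: "graded gensA d X \<Longrightarrow> graded gensA (d - 1) (DA X)"
  by (rule graded_sder) (auto intro: graded_sdeltaA)

lemma sv_cancel: "sv * X = sv * Y \<Longrightarrow> X = Y"
  by (metis inverses_cancel(8))

context bigon_derivation
begin

text \<open>At this stage D is not known to square to zero on \<open>Gg\<close>, but s lies in A^2,
  where D agrees with \<open>DA\<close>.\<close>

lemma DD_sv: "D (D sv) = 0"
proof -
  have g: "graded gensA 0 sv"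
    unfolding sv_def sexp_def by (intro graded_fev graded_arith graded_v_ser)
  show ?thesis by (simp add: D_eq_DA[OF g] D_eq_DA[OF graded_DA[OF g]] DA_DA)
qed

text \<open>Differentiating s x = a s + D(s) gives s D(x) = -(a s + D(s)) x: gauge transport
  preserves the Maurer-Cartan equation of a.\<close>

lemma D_x_ser: "D x_ser = - (x_ser * x_ser)"
proof (rule sv_cancel)
  have "D sv * x_ser + sv * D x_ser = D (ga * sv + D sv)"
    unfolding sv_x_ser[symmetric] by (simp add: D_even)
  also have "\<dots> = - (ga * (ga * sv)) - ga * D sv"
    by (simp add: D_mult D_a DD_sv mult.assoc)
  also have "\<dots> = - (ga * (sv * x_ser))"
    unfolding sv_x_ser by (simp add: distrib_left)
  finally have "sv * D x_ser = - ((ga * sv + D sv) * x_ser)"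
    by (simp add: algebra_simps eq_neg_iff_add_eq_0)
  then show "sv * D x_ser = sv * - (x_ser * x_ser)"
    unfolding sv_x_ser[symmetric] by (simp add: mult.assoc)
qed

text \<open>exp(q) is the loop at a conjugated by s, so it satisfies the stabiliser equation at x,
  and hence so does its logarithm.\<close>

lemma D_q_ser: "D q_ser = q_ser * x_ser - x_ser * q_ser"
proof -
  let ?k = "sexp q_ser"
  have k: "sv * ?k = pe * (pf * sv)" by (simp add: sexp_q_ser)
  have "D ?k = ?k * x_ser - x_ser * ?k"
  proof (rule sv_cancel)
    have "D sv * ?k + sv * D ?k = D (sv * ?k)" by (simp add: D_even)
    also have "\<dots> = pe * (pf * (ga * sv + D sv)) - ga * (sv * ?k)"
      unfolding k by (simp add: D_even D_pe D_pf algebra_simps)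
    also have "\<dots> = sv * ?k * x_ser - ga * (sv * ?k)"
      unfolding sv_x_ser[symmetric] k by (simp add: mult.assoc)
    finally have "sv * D ?k = sv * ?k * x_ser - (ga * sv + D sv) * ?k"
      by (simp add: algebra_simps eq_diff_eq)
    then show "sv * D ?k = sv * (?k * x_ser - x_ser * ?k)"
      unfolding sv_x_ser[symmetric] by (simp add: algebra_simps)
  qed
  then have "D (slog ?k) = slog ?k * x_ser - x_ser * slog ?k"
    by (intro D_stabiliser_slog) (simp_all add: sexp_def eps_fev)
  then show ?thesis by (simp add: slog_sexp)
qed

end

subsection \<open>Symmetries\<close>

text \<open>Covers both symmetries, which permute generators up to sign. On coefficients a
  permutation acts through its inverse, which for an involution g is g itself.\<close>

definition relabel :: "(gen \<Rightarrow> rat) \<Rightarrow> (gen \<Rightarrow> gen) \<Rightarrow> ser \<Rightarrow> ser" where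
  "relabel c g X = Ser (\<lambda>w. prod_list (map c w) * cf X (map g w))"

lemma cf_relabel [simp]: "cf (relabel c g X) w = prod_list (map c w) * cf X (map g w)"
  by (simp add: relabel_def)

lemma local_linear_relabel: "local_linear (relabel c g)"
  by (rule local_linearI) (auto intro!: ser_eqI simp: algebra_simps vanish_def)

lemma relabel_1 [simp]: "relabel c g 1 = 1"
  by (rule ser_eqI) (simp add: cf_1)

lemma relabel_mult: "relabel c g (X * Y) = relabel c g X * relabel c g Y"
proof (rule ser_eqI)
  fix w
  have "prod_list (map c w) = prod_list (map c (take i w)) * prod_list (map c (drop i w))" for i
    by (metis append_take_drop_id map_append prod_list.append)
  then have "prod_list (map c w) * (cf X (take i (map g w)) * cf Y (drop i (map g w)))
      = prod_list (map c (take i w)) * cf X (map g (take i w)) * (prod_list (map c (drop i w)) * cf Y (map g (drop i w)))" for i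
    by (simp add: take_map drop_map mult_ac)
  then show "cf (relabel c g (X * Y)) w = cf (relabel c g X * relabel c g Y) w"
    unfolding cf_mult cf_relabel sum_distrib_left length_map by presburger
qed

lemma relabel_lgen:
  assumes "\<And>x. g (g x) = x"
  shows "relabel c g (lgen x) = c (g x) \<bullet> lgen (g x)"
proof (rule ser_eqI)
  fix w
  show "cf (relabel c g (lgen x)) w = cf (c (g x) \<bullet> lgen (g x)) w"
    using assms by (auto simp: cf_lgen map_eq_Cons_conv)
qed

lemma relabel_relabel:
  assumes "\<And>x. g (g x) = x" "\<And>x. c x * c (g x) = 1"
  shows "relabel c g (relabel c g X) = X"
proof (rule ser_eqI)
  fix w
  have "map g (map g w) = w" using assms(1) by (simp add: map_idI)
  moreover have "prod_list (map c w) * prod_list (map c (map g w)) = 1"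
  proof (induction w)
    case (Cons x w)
    then show ?case using assms(2)[of x] by (simp add: mult_ac)
  qed simp
  ultimately show "cf (relabel c g (relabel c g X)) w = cf X w"
    by (simp add: mult.assoc[symmetric])
qed

lemma relabel_eps:
  assumes "\<And>x. odd (gdeg (g x)) = odd (gdeg x)"
  shows "relabel c g (eps X) = eps (relabel c g X)"
proof (rule ser_eqI)
  fix w
  have "wsign (map g w) = (wsign w :: rat)"
    using assms by (simp add: wsign_def filter_map comp_def)
  then show "cf (relabel c g (eps X)) w = cf (eps (relabel c g X)) w" by simp
qed

definition sig :: "ser \<Rightarrow> ser" where "sig = relabel (\<lambda>x. 1) sig_g"
definition iot :: "ser \<Rightarrow> ser" where "iot = relabel (\<lambda>x. if x \<in> {Ge, Gf, Gg} then - 1 else 1) iota_g"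

lemma sig_iota_involutions: "sig_g (sig_g x) = x" "iota_g (iota_g x) = x"
  by (cases x; simp)+

lemma sigma_s_cf: "sigma_s (cf X) = cf (sig X)"
  by (rule ext) (simp add: sigma_s_def sig_def map_replicate_const)

lemma iota_s_cf: "iota_s (cf X) = cf (iot X)"
proof
  fix w
  have "prod_list (map (\<lambda>x. if x \<in> {Ge, Gf, Gg} then - 1 else 1) w)
    = (- 1 :: rat) ^ length (filter (\<lambda>y. y \<in> {Ge, Gf, Gg}) w)"
    by (induction w) simp_all
  then show "iota_s (cf X) w = cf (iot X) w" by (simp add: iota_s_def iot_def)
qed

lemma sig_hom:
  "local_linear sig" "sig 1 = 1" "sig (X * Y) = sig X * sig Y" "sig (eps X) = eps (sig X)"
  "sig (sig X) = X" "sig ga = gb" "sig gb = ga" "sig ge = gf" "sig gf = ge" "sig gg = gg"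
proof -
  have "odd (gdeg (sig_g x)) = odd (gdeg x)" for x by (cases x) simp_all
  then show "sig (eps X) = eps (sig X)" unfolding sig_def by (rule relabel_eps)
qed (simp_all add: sig_def local_linear_relabel relabel_mult relabel_relabel relabel_lgen sig_iota_involutions)

lemma iot_hom:
  "local_linear iot" "iot 1 = 1" "iot (X * Y) = iot X * iot Y" "iot (eps X) = eps (iot X)"
  "iot (iot X) = X" "iot ga = ga" "iot gb = gb" "iot ge = - gf" "iot gf = - ge" "iot gg = - gg"
proof -
  have "odd (gdeg (iota_g x)) = odd (gdeg x)" for x by (cases x) simp_all
  then show "iot (eps X) = eps (iot X)" unfolding iot_def by (rule relabel_eps)
  have "(if x \<in> {Ge, Gf, Gg} then - 1 else 1) * (if iota_g x \<in> {Ge, Gf, Gg} then - 1 else 1) = (1::rat)" for x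
    by (cases x) simp_all
  then show "iot (iot X) = X" unfolding iot_def by (intro relabel_relabel sig_iota_involutions)
qed (simp_all add: iot_def local_linear_relabel relabel_mult relabel_lgen sig_iota_involutions)

lemmas sig_linear = local_linearD(1,2,4-7)[OF sig_hom(1)]
lemmas iot_linear = local_linearD(1,2,4-7)[OF iot_hom(1)]

lemma Lie_sig: "Lie X \<Longrightarrow> Lie (sig X)"
proof (rule Lie_ring_hom[OF sig_hom(1,3,4)])
  show "Lie (sig (lgen x))" for x by (cases x) (simp_all add: sig_hom Lie_lgen)
qed

lemma Lie_iot: "Lie X \<Longrightarrow> Lie (iot X)"
proof (rule Lie_ring_hom[OF iot_hom(1,3,4)])
  show "Lie (iot (lgen x))" for x by (cases x) (simp_all add: iot_hom Lie_lgen Lie_uminus)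
qed

lemma ring_hom_sexp:
  assumes "local_linear S" "S 1 = 1" "\<And>X Y. S (X * Y) = S X * S Y" "cf X [] = 0"
  shows "S (sexp X) = sexp (S X)"
  unfolding sexp_def by (rule ring_hom_fev[OF assms])

lemma ring_hom_slog:
  assumes S: "local_linear S" "S 1 = 1" "\<And>X Y. S (X * Y) = S X * S Y" and "cf G [] = 1"
  shows "S (slog G) = slog (S G)"
  unfolding slog_def using assms(4)
  by (subst ring_hom_fev[OF S]) (simp_all add: cf_1 S(2) local_linearD(6)[OF S(1)])

lemmas sig_sexp = ring_hom_sexp[OF sig_hom(1-3)]
lemmas iot_sexp = ring_hom_sexp[OF iot_hom(1-3)]

lemma sig_Nil [simp]: "cf (sig X) [] = cf X []" and iot_Nil [simp]: "cf (iot X) [] = cf X []"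
  by (simp_all add: sig_def iot_def)

lemma sexp_inj: "sexp X = sexp Y \<Longrightarrow> cf X [] = 0 \<Longrightarrow> cf Y [] = 0 \<Longrightarrow> X = Y"
  by (metis slog_sexp)

lemma inverse_unique: "A * B = 1 \<Longrightarrow> C * A = 1 \<Longrightarrow> B = (C :: ser)"
  by (metis mult.assoc mult_1_left mult_1_right)

lemma slog_holonomy: "slog (pe * pf) = h_ser"
  by (simp add: h_ser_def sBCH_def)

lemma sig_pe: "sig pe = pf" "sig pf = pe" "sig pe' = pf'" "sig pf' = pe'"
  by (simp_all add: sig_sexp sig_hom sig_linear)

lemma iot_pe: "iot pe = pf'" "iot pf = pe'" "iot pe' = pf" "iot pf' = pe"
  by (simp_all add: iot_sexp iot_hom iot_linear)

text \<open>Conjugation by \<open>exp e\<close> takes \<open>exp e exp f\<close> to \<open>exp f exp e\<close>.\<close>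
lemma sig_me: "sig me = pe' * me * pe"
proof -
  let ?C = "\<lambda>X. pe' * X * pe"
  have C: "local_linear ?C" "?C 1 = 1" "\<And>X Y. ?C (X * Y) = ?C X * ?C Y"
    using local_linear_comp[OF local_linear_mult_right local_linear_mult_left]
    by (simp_all add: mult.assoc)
  have "sig h_ser = slog (sig (pe * pf))"
    unfolding slog_holonomy[symmetric] by (rule ring_hom_slog[OF sig_hom(1-3)]) simp
  also have "sig (pe * pf) = ?C (pe * pf)"
    by (simp add: sig_hom(3) sig_pe mult.assoc)
  also have "slog (?C (pe * pf)) = ?C h_ser"
    unfolding slog_holonomy[symmetric] by (rule ring_hom_slog[OF C, symmetric]) simp
  finally have "sig h_ser = ?C h_ser" .
  moreover have "sexp (?C ((- 1/2) \<bullet> h_ser)) = ?C me"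
    unfolding me_def by (rule ring_hom_sexp[OF C, symmetric]) simp
  ultimately show ?thesis
    unfolding me_def by (subst sig_sexp) (simp_all add: sig_linear)
qed

text \<open>Applying \<open>sig\<close> to h^(-1/2) exp(e) gives exp(-e) h^(-1/2) exp(e) exp(f) =
  exp(-e) h^(1/2), its inverse.\<close>

lemma sig_v_ser: "sig v_ser = - v_ser"
proof (rule sexp_inj)
  have "sexp (sig v_ser) = pe' * me'"
    by (simp add: sig_sexp[symmetric] sexp_v_ser sig_hom(3) sig_pe sig_me mult.assoc me_holonomy)
  moreover have "sexp (- v_ser) = pe' * me'"
    by (rule inverse_unique[of "me * pe"])
       (simp_all add: sexp_v_ser[symmetric] sexp_inverse, simp add: sexp_v_ser mult.assoc)
  ultimately show "sexp (sig v_ser) = sexp (- v_ser)" by simp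
qed simp_all

lemma sig_sv: "sig sv = sv'" "sig sv' = sv"
  by (simp_all add: sv_def sv'_def sig_sexp sig_linear sig_v_ser scl_distribs)

lemma iot_h_ser: "iot h_ser = - h_ser"
proof (rule sexp_inj)
  have "sexp (iot h_ser) = pf' * pe'"
    by (simp add: iot_sexp[symmetric] sexp_h_ser iot_hom(3) iot_pe)
  moreover have "sexp (- h_ser) = pf' * pe'"
    by (rule inverse_unique[of "pe * pf"])
       (simp_all add: sexp_h_ser[symmetric] sexp_inverse, simp add: sexp_h_ser mult.assoc)
  ultimately show "sexp (iot h_ser) = sexp (- h_ser)" by simp
qed simp_all

lemma iot_me: "iot me = me'"
  by (simp add: me_def me'_def iot_sexp iot_linear iot_h_ser scl_distribs)

text \<open>\<open>iot\<close> inverts h and sends exp(e) to exp(-f), so exp(v) becomes h^(1/2)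
  exp(-f), its other expression.\<close>

lemma iot_v_ser: "iot v_ser = v_ser"
proof (rule sexp_inj)
  have "sexp (iot v_ser) = me' * pf'"
    by (simp add: iot_sexp[symmetric] sexp_v_ser iot_hom(3) iot_pe iot_me)
  also have "\<dots> = sexp v_ser"
    by (simp add: me_holonomy(1)[symmetric] sexp_v_ser mult.assoc)
  finally show "sexp (iot v_ser) = sexp v_ser" .
qed simp_all

lemma iot_sv: "iot sv = sv" "iot sv' = sv'"
  by (simp_all add: sv_def sv'_def iot_sexp iot_linear iot_v_ser)

lemma sig_q_ser: "sig q_ser = q_ser"
proof (rule sexp_inj)
  have "sig (sexp q_ser) = sv * (pf * (pe * sv'))"
    by (simp add: sexp_q_ser sig_hom(3) sig_pe sig_sv)
  \<comment> \<open>Inserting s^2 = h^(-1/2) exp(e) completes the reversed loop to h; moving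
    h^(-1/2) past h recreates s^2 on the right.\<close>
  also have "\<dots> = sv' * (sv * sv) * (pf * (pe * sv'))" by (simp add: mult.assoc)
  also have "\<dots> = sv' * (me * (pe * pf) * (pe * sv'))" by (simp add: sv_sv mult.assoc)
  also have "me * (pe * pf) = pe * pf * me" by (simp add: me_holonomy mult.assoc)
  also have "sv' * (pe * pf * me * (pe * sv')) = sv' * (pe * pf * (me * pe) * sv')"
    by (simp only: mult.assoc)
  also have "\<dots> = sv' * (pe * (pf * sv))" by (simp add: sv_sv[symmetric] mult.assoc)
  finally show "sexp (sig q_ser) = sexp q_ser" by (simp add: sig_sexp[symmetric] sexp_q_ser)
qed simp_all

lemma iot_q_ser: "iot q_ser = - q_ser"
proof (rule sexp_inj)
  have "sexp (iot q_ser) = sv' * (pf' * (pe' * sv))"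
    by (simp add: iot_sexp[symmetric] sexp_q_ser iot_hom(3) iot_pe iot_sv)
  moreover have "sexp (- q_ser) = sv' * (pf' * (pe' * sv))"
    by (rule inverse_unique[of "sexp q_ser"])
       (simp_all add: sexp_inverse, simp add: sexp_q_ser mult.assoc)
  ultimately show "sexp (iot q_ser) = sexp (- q_ser)" by simp
qed simp_all

context bigon_derivation
begin

lemma D_inverse:
  assumes "A * B = 1" "B * A = 1" "eps A = A"
  shows "D B = - (B * D A * B)"
proof -
  have "D (A * B) = 0" using assms by simp
  then have "A * D B = - (D A * B)" by (simp add: D_even[OF assms(3)] eq_neg_iff_add_eq_0 add.commute)
  then have "B * (A * D B) = - (B * D A * B)" by (simp add: mult.assoc)
  then show ?thesis by (simp add: inverse_cancel[OF assms(2)])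
qed

lemma D_sig_edges: "D (sig pe) = sig (D pe)" "D (sig pf) = sig (D pf)"
  "D (sig ga) = sig (D ga)" "D (sig gb) = sig (D gb)"
  by (simp_all add: sig_pe D_pe D_pf D_a D_b sig_hom sig_linear)

lemma D_iot_edges: "D (iot pe) = iot (D pe)" "D (iot pf) = iot (D pf)"
  "D (iot ga) = iot (D ga)" "D (iot gb) = iot (D gb)"
proof -
  \<comment> \<open>Since f runs from b to a, exp(-f) is a transport from a to b just like exp(e);
    likewise exp(-e) behaves like exp(f).\<close>
  have "D pf' = pf' * gb - ga * pf'" "D pe' = pe' * ga - gb * pe'"
    by (subst D_inverse[OF inverses(3,4)] D_inverse[OF inverses(1,2)], simp,
        simp add: D_pe D_pf algebra_simps)+
  then show "D (iot pe) = iot (D pe)" "D (iot pf) = iot (D pf)"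
    by (simp_all add: iot_pe D_pe D_pf iot_hom iot_linear)
qed (simp_all add: D_a D_b iot_hom iot_linear)

lemma D_sig: "D (sig gg) = sig (D gg) \<Longrightarrow> D (sig X) = sig (D X)"
  by (rule D_commute[OF sig_hom(1-4) D_sig_edges(3,4) _ D_sig_edges(1,2)])

lemma D_iot: "D (iot gg) = iot (D gg) \<Longrightarrow> D (iot X) = iot (D X)"
  by (rule D_commute[OF iot_hom(1-4) D_iot_edges(3,4) _ D_iot_edges(1,2)])

end

lemma DA_sig: "DA (sig X) = sig (DA X)" and DA_iot: "DA (iot X) = iot (DA X)"
  by (rule A.D_sig A.D_iot, simp add: A.D_lgen sig_hom(6-10) iot_hom(6-10) sdeltaA_values sig_linear iot_linear)+

lemma iot_x_ser: "iot x_ser = x_ser"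
proof (rule sv_cancel)
  have "sv * iot x_ser = iot (sv * x_ser)" by (simp add: iot_hom(3) iot_sv)
  then show "sv * iot x_ser = sv * x_ser"
    unfolding A.sv_x_ser by (simp add: iot_hom(3,6) iot_sv iot_linear DA_iot[symmetric])
qed

text \<open>The image of x is the point reached from b by s^(-1). Since s^2 transports a to b, going
  back half way from b meets the point half way from a.\<close>

lemma sig_x_ser: "sig x_ser = x_ser"
proof -
  have "sv' * sig x_ser = sig (sv * x_ser)" by (simp add: sig_hom(3) sig_sv)
  also have "\<dots> = gb * sv' + DA sv'"
    unfolding A.sv_x_ser by (simp add: sig_hom(3,6) sig_sv sig_linear DA_sig[symmetric])
  finally have 1: "sv' * sig x_ser = gb * sv' + DA sv'" .
  have 2: "DA sv' = - (sv' * DA sv * sv')" by (rule A.D_inverse) simp_all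
  have "DA (sv * sv) = sv * sv * gb - ga * (sv * sv)"
    unfolding sv_sv by (simp add: A.D_even A.D_me A.D_pe algebra_simps)
  then have 3: "sv * (sv * gb) = ga * (sv * sv) + DA sv * sv + sv * DA sv"
    by (simp add: A.D_even algebra_simps)
  have "sv * (sv * (gb * sv' + DA sv')) = sv * (sv * gb) * sv' - sv * (DA sv * sv')"
    by (simp add: 2 algebra_simps)
  also have "\<dots> = ga * sv + DA sv"
    unfolding 3 by (simp add: algebra_simps)
  also have "\<dots> = sv * (sv * (sv' * x_ser))"
    by (simp add: A.sv_x_ser)
  finally have "sv * (sv * (sv' * sig x_ser)) = sv * (sv * (sv' * x_ser))" unfolding 1 .
  then show ?thesis by (simp add: inverses_cancel) (metis sv_cancel)
qed

section \<open>The extended differential\<close>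

abbreviation DB :: "ser \<Rightarrow> ser" where "DB \<equiv> sder sdeltaBar"

lemma sdeltaBar_values: "x \<noteq> Gg \<Longrightarrow> sdeltaBar x = sdeltaA x" "sdeltaBar Gg = q_ser - sbrk x_ser gg"
proof -
  show "x \<noteq> Gg \<Longrightarrow> sdeltaBar x = sdeltaA x" by (cases x) (simp_all add: sdeltaBar_def sdeltaA_def)
  show "sdeltaBar Gg = q_ser - sbrk x_ser gg"
    by (rule ser_eqI) (simp add: sdeltaBar_def q_el_eq x_el_eq gen_s_cf brk_cf)
qed

lemma graded_sdeltaBar_g: "graded UNIV 0 (sdeltaBar Gg)"
proof -
  have "graded UNIV (- 1 + 1) (sbrk x_ser gg)"
    by (intro graded_sbrk graded_UNIV[OF graded_x_ser]) (use graded_lgen[of Gg UNIV] in simp)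
  then show ?thesis
    unfolding sdeltaBar_values by (intro graded_arith graded_UNIV[OF graded_q_ser]) simp
qed

interpretation B: bigon_derivation sdeltaBar
proof
  show "degree_lowering sdeltaBar"
    unfolding degree_lowering_def
  proof (intro allI conjI)
    show "cf (sdeltaBar x) [] = 0" for x
      by (cases "x = Gg") (simp_all add: sdeltaBar_values sdeltaA_Nil sbrk_eq)
    show "graded UNIV (gdeg x - 1) (sdeltaBar x)" for x
      using graded_sdeltaBar_g by (cases "x = Gg") (simp_all add: sdeltaBar_values(1) graded_sdeltaA)
  qed
qed (rule sdeltaBar_values)

lemma DB_g: "DB gg = q_ser - (x_ser * gg + gg * x_ser)"
  by (simp add: B.D_lgen sdeltaBar_values sbrk_odd)

lemma DB_DB: "DB (DB X) = 0"
proof (rule B.DD_eq_0)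
  \<comment> \<open>The terms containing g cancel by the Maurer-Cartan equation; what remains of D(x
    g + g x) is q x - x q, which is D(q).\<close>
  show "DB (DB gg) = 0"
    by (simp add: DB_g B.D_mult B.D_x_ser B.D_q_ser algebra_simps)
qed

lemma DB_sig: "DB (sig X) = sig (DB X)"
  by (rule B.D_sig) (simp add: DB_g sig_hom(3,10) sig_linear sig_x_ser sig_q_ser)

lemma DB_iot: "DB (iot X) = iot (DB X)"
  by (rule B.D_iot) (simp add: DB_g iot_hom(3,10) iot_linear iot_x_ser iot_q_ser)

lemma Lie_DB: "Lie X \<Longrightarrow> Lie (DB X)"
proof (rule Lie_sder[OF B.lowering])
  show "Lie (sdeltaBar x)" for x
    by (cases "x = Gg") (simp_all add: sdeltaBar_values Lie_sdeltaA Lie_diff Lie_q_ser Lie_sbrk Lie_x_ser Lie_lgen)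
qed

lemma dBar_cf: "dBar (cf X) = cf (DB X)"
  by (simp add: dBar_def sder_def sdeltaBar_def)

lemma dBar_eq_dA:
  assumes "inA X"
  shows "dBar X = dA X"
proof
  fix w
  have "X (u @ [x] @ v) * deltaBar x t = X (u @ [x] @ v) * deltaA x t" for u x v t
  proof (cases "x = Gg")
    case True
    then have "X (u @ [x] @ v) = 0" using assms by (auto simp: inA_def)
    then show ?thesis by simp
  next
    case False
    then show ?thesis by (cases x) simp_all
  qed
  then show "dBar X w = dA X w"
    unfolding dBar_def dA_def der_def by (simp only: mult.assoc)
qed

section \<open>Bracket-free parts of the boundaries\<close>

lemma phi_0: "fps_nth phi1 0 = - 1" "fps_nth phi2 0 = 1"
proof -
  \<comment> \<open>Since 1 - exp(c t) starts with -c t, the coefficient of t in each product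
    isolates the constant coefficient of the other factor.\<close>
  have "fps_nth (phi1 * (1 - fps_exp 1)) 1 = 1" "fps_nth (phi2 * (1 - fps_exp (- 1))) 1 = 1"
    unfolding phi1_mult phi2_mult by simp_all
  then show "fps_nth phi1 0 = - 1" "fps_nth phi2 0 = 1"
    by (simp_all add: fps_mult_nth_1)
qed

lemma length_le_1_cases: "length w \<le> Suc 0 \<Longrightarrow> w = [] \<or> (\<exists>y. w = [y])"
  by (cases w) auto

lemma cf_mult_single: "cf (X * Y) [y] = cf X [y] * cf Y [] + cf X [] * cf Y [y]"
  by (simp add: cf_mult)

text \<open>A commutator of series without constant term has only words of length at least 2, so
  only n = 0 contributes.\<close>

lemma fop_comm_linear_part:
  assumes "cf Z [] = 0" "cf X [] = 0" "length w \<le> 1"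
  shows "cf (fop \<phi> (comm Z) X) w = fps_nth \<phi> 0 * cf X w"
  using length_le_1_cases[of w] assms
  by (auto simp: fop_def cf_Ssum comm_def cf_mult_single)

lemma sexp_single: "cf X [] = 0 \<Longrightarrow> cf (sexp X) [y] = cf X [y]"
  by (simp add: sexp_def cf_fev_single)

text \<open>Up to length 1 an exponential is 1 plus its exponent, so the product becomes a sum in
  which the two halves of v cancel.\<close>

lemma q_ser_linear_part:
  assumes "length w \<le> 1"
  shows "cf q_ser w = cf ge w + cf gf w"
proof -
  have "cf q_ser [y] = cf (sexp q_ser) [y]" for y by (simp add: sexp_single)
  also have "\<dots> y = cf ge [y] + cf gf [y]" for y
    unfolding sexp_q_ser by (simp add: cf_mult_single sexp_single sv_def sv'_def)
  finally show ?thesis using length_le_1_cases[of w] assms by auto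
qed

lemma boundary_linear_parts:
  assumes "length w \<le> 1"
  shows "cf (DB ga) w = 0" "cf (DB gb) w = 0" "cf (DB ge) w = cf gb w - cf ga w"
    "cf (DB gf) w = cf ga w - cf gb w" "cf (DB gg) w = cf ge w + cf gf w"
proof -
  have m: "cf (X * Y) w = 0" if "cf X [] = 0" "cf Y [] = 0" for X Y
    using length_le_1_cases[of w] assms that by (auto simp: cf_mult_single)
  show "cf (DB ga) w = 0" "cf (DB gb) w = 0" by (simp_all add: B.D_a B.D_b m)
  show "cf (DB ge) w = cf gb w - cf ga w" "cf (DB gf) w = cf ga w - cf gb w"
    using assms
    by (simp_all add: B.D_lgen sdeltaBar_values(1) sdeltaA_values fop_comm_linear_part phi_0)
  show "cf (DB gg) w = cf ge w + cf gf w" by (simp add: DB_g m q_ser_linear_part[OF assms])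
qed

lemma A2_I:
  assumes "graded gensA d X" "Lie X"
  shows "cf X \<in> A2 d"
  using assms by (auto simp: A2_def Abar_def inA_def Lie_iff graded_def gensA_def)

theorem mainTheorem3:
  shows
    \<comment> \<open>the data: q in A^2_0, x in A^2_{-1}, and dBar g in bar A^2_0\<close>
    "q_el \<in> A2 0 \<and> x_el \<in> A2 (-1) \<and> dBar (gen_s Gg) \<in> Abar 0
    \<comment> \<open>dBar is a derivation of bar A^2 extending d on A^2\<close>
    \<and> (\<forall>X. lie_series X \<longrightarrow> lie_series (dBar X))
    \<and> (\<forall>X. inA X \<longrightarrow> dBar X = dA X)
    \<comment> \<open>dBar^2 = 0 on bar A^2\<close>
    \<and> (\<forall>X. lie_series X \<longrightarrow> dBar (dBar X) = (\<lambda>w. 0))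
    \<comment> \<open>bracket-free parts of the boundaries (bi-gon): a, b have none; e: b - a; f: a - b; g: e + f\<close>
    \<and> (\<forall>w. length w \<le> 1 \<longrightarrow> dBar (gen_s Ga) w = 0 \<and> dBar (gen_s Gb) w = 0)
    \<and> (\<forall>w. length w \<le> 1 \<longrightarrow> dBar (gen_s Ge) w = gen_s Gb w - gen_s Ga w)
    \<and> (\<forall>w. length w \<le> 1 \<longrightarrow> dBar (gen_s Gf) w = gen_s Ga w - gen_s Gb w)
    \<and> (\<forall>w. length w \<le> 1 \<longrightarrow> dBar (gen_s Gg) w = gen_s Ge w + gen_s Gf w)
    \<comment> \<open>sigma and iota are automorphisms of bar A^2 commuting with dBar\<close>
    \<and> (\<forall>X. lie_series X \<longrightarrow> lie_series (sigma_s X) \<and> lie_series (iota_s X))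
    \<and> (\<forall>X Y. sigma_s (brk X Y) = brk (sigma_s X) (sigma_s Y)
              \<and> iota_s (brk X Y) = brk (iota_s X) (iota_s Y))
    \<and> (\<forall>X. sigma_s (sigma_s X) = X \<and> iota_s (iota_s X) = X)
    \<and> (\<forall>X. lie_series X \<longrightarrow> dBar (sigma_s X) = sigma_s (dBar X)
                            \<and> dBar (iota_s X) = iota_s (dBar X))
    \<comment> \<open>d_x g = q\<close>
    \<and> (\<lambda>w. dBar (gen_s Gg) w + brk x_el (gen_s Gg) w) = q_el"
proof -
  have "q_el \<in> A2 0" "x_el \<in> A2 (- 1)"
    unfolding q_el_eq x_el_eq by (intro A2_I graded_q_ser graded_x_ser Lie_q_ser Lie_x_ser)+
  moreover have "dBar (gen_s Gg) \<in> Abar 0"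
    using graded_sdeltaBar_g Lie_DB[OF Lie_lgen]
    by (auto simp: gen_s_cf dBar_cf Abar_def Lie_iff graded_def B.D_lgen)
  moreover have "lie_series (dBar X)" if "lie_series X" for X
    using Lie_DB[of "Ser X"] that by (simp add: Lie_iff dBar_cf[symmetric])
  moreover have "dBar (dBar X) = (\<lambda>w. 0)" for X
  proof -
    have "dBar X = cf (DB (Ser X))" using dBar_cf[of "Ser X"] by simp
    then show ?thesis unfolding dBar_cf by (simp only: dBar_cf DB_DB zero_ser.rep_eq)
  qed
  moreover have "lie_series (sigma_s X)" "lie_series (iota_s X)" if "lie_series X" for X
    using Lie_sig[of "Ser X"] Lie_iot[of "Ser X"] that
    by (simp_all add: Lie_iff sigma_s_cf[symmetric] iota_s_cf[symmetric])
  moreover have "sigma_s (brk X Y) = brk (sigma_s X) (sigma_s Y)"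
      "iota_s (brk X Y) = brk (iota_s X) (iota_s Y)" for X Y
    using ring_hom_sbrk[OF sig_hom(1,3,4), of "Ser X" "Ser Y"]
      ring_hom_sbrk[OF iot_hom(1,3,4), of "Ser X" "Ser Y"]
    by (metis brk_cf sigma_s_cf iota_s_cf cf_Ser)+
  moreover have "sigma_s (sigma_s X) = X" "iota_s (iota_s X) = X" for X
    by (metis sigma_s_cf iota_s_cf cf_Ser sig_hom(5) iot_hom(5))+
  moreover have "dBar (sigma_s X) = sigma_s (dBar X)" "dBar (iota_s X) = iota_s (dBar X)" for X
    by (metis sigma_s_cf iota_s_cf cf_Ser dBar_cf DB_sig DB_iot)+
  moreover have "(\<lambda>w. dBar (gen_s Gg) w + brk x_el (gen_s Gg) w) = q_el"
    by (rule ext) (simp add: gen_s_cf dBar_cf x_el_eq q_el_eq brk_cf B.D_lgen sdeltaBar_values)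
  ultimately show ?thesis
    using boundary_linear_parts dBar_eq_dA by (simp add: gen_s_cf dBar_cf)
qed

end
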